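(* Let $\mathcal{A}$ be a BT partition sort algorithm that sorts the permutation $\pi$ of $\{1,\dots,n\}$ using $\mathcal{A}(\pi)$ accesses, and let $\mathrm{OPT}_{\mathrm{BST}}(\pi)$ be the optimal cost of querying $\pi$ with a BST algorithm. Then $\mathrm{OPT}_{\mathrm{BST}}(\pi)\in O(\mathcal{A}(\pi))$.
   Context: BST model: keys $\{1,\dots,n\}$ stored in a BST; an access sequence is served in order, each search starting at the root and at each step moving the pointer to the parent or a child or rotating the current node with its parent, each at unit cost; the search must visit its key. $\mathrm{OPT}_{\mathrm{BST}}(\pi)$ is the minimum cost of an offline BST algorithm serving $\pi$. A top tree of a binary tree $T$ is a connected set of nodes containing the root. BT partition: given a binary tree (BT) $T$ (not key-ordered; its left-to-right order of keys represents input order), for some top tree $\tau$ of $T$ it returns two nonempty BTs $T_A,T_B$ with distinct keys such that for some top trees $\tau_a$ of $T_A$, $\tau_b$ of $T_B$, $\tau=\tau_a\cup\tau_b$, the other subtrees of $T$ appear unchanged in $T_A$ or $T_B$, $\tau$ contains the block boundaries (blocks: maximal contiguous runs, in the left-to-right order of $T$, of keys sent to the same output; boundaries: their first and last keys), and the left-to-right orders of keys in $T_A$ and in $T_B$ are subsequences of that in $T$. Number of accesses: $|\tau|$. BT partition sort: on a BT of size one it stops; otherwise it BT-partitions $T$ into $T_a,T_b$ such that for some key $k$ all keys in $T_a$ are $<k$ and all keys in $T_b$ are $\ge k$, recurses on each, and appends the results. It sorts $\pi$ when started on a BT whose left-to-right order of keys is $\pi$. Number of accesses: the sum over all partitions.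 *)

theory Defs
  imports Complex_Main "HOL-Library.Tree" "HOL-Library.Sublist"
begin

(* A pointer is a path from the root: False = go left, True = go right. *)
type_synonym path = "bool list"

fun subtree_at :: "'a tree \<Rightarrow> path \<Rightarrow> 'a tree" where
  "subtree_at t [] = t"
| "subtree_at Leaf (d # p) = Leaf"
| "subtree_at (Node l x r) (d # p) = (if d then subtree_at r p else subtree_at l p)"

fun update_at :: "'a tree \<Rightarrow> path \<Rightarrow> ('a tree \<Rightarrow> 'a tree) \<Rightarrow> 'a tree" where
  "update_at t [] f = f t"
| "update_at Leaf (d # p) f = Leaf"
| "update_at (Node l x r) (d # p) f =
     (if d then Node l x (update_at r p f) else Node (update_at l p f) x r)"

fun rot_left_child_up :: "'a tree \<Rightarrow> 'a tree" where
  "rot_left_child_up (Node (Node a x b) y c) = Node a x (Node b y c)"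
| "rot_left_child_up t = t"

fun rot_right_child_up :: "'a tree \<Rightarrow> 'a tree" where
  "rot_right_child_up (Node a y (Node b x c)) = Node (Node a y b) x c"
| "rot_right_child_up t = t"

inductive bst_step :: "'a tree \<times> path \<Rightarrow> 'a tree \<times> path \<Rightarrow> bool" where
  to_parent: "p \<noteq> [] \<Longrightarrow> bst_step (t, p) (t, butlast p)"
| to_left: "subtree_at t p = Node l x r \<Longrightarrow> l \<noteq> Leaf \<Longrightarrow> bst_step (t, p) (t, p @ [False])"
| to_right: "subtree_at t p = Node l x r \<Longrightarrow> r \<noteq> Leaf \<Longrightarrow> bst_step (t, p) (t, p @ [True])"
| rotate_up: "p \<noteq> [] \<Longrightarrow> subtree_at t p \<noteq> Leaf \<Longrightarrow>
     bst_step (t, p)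
       (update_at t (butlast p) (if last p then rot_right_child_up else rot_left_child_up),
        butlast p)"

fun key_at :: "'a tree \<times> path \<Rightarrow> 'a option" where
  "key_at (t, p) = (case subtree_at t p of Leaf \<Rightarrow> None | Node _ x _ \<Rightarrow> Some x)"

definition search :: "'a tree \<Rightarrow> 'a \<Rightarrow> 'a tree \<Rightarrow> nat \<Rightarrow> bool" where
  "search t q t' c \<longleftrightarrow> (\<exists>s c1 c2 p'. (bst_step ^^ c1) (t, []) s \<and> key_at s = Some q
       \<and> (bst_step ^^ c2) s (t', p') \<and> c = c1 + c2)"

inductive serve :: "'a tree \<Rightarrow> 'a list \<Rightarrow> nat \<Rightarrow> bool" where
  "serve t [] 0"
| "search t q t' c \<Longrightarrow> serve t' qs c' \<Longrightarrow> serve t (q # qs) (c + c')"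

definition OPT_BST :: "nat list \<Rightarrow> nat" where
  "OPT_BST \<pi> = (LEAST c. \<exists>t0. bst t0 \<and> set_tree t0 = {1..length \<pi>} \<and> serve t0 \<pi> c)"

fun conn_top :: "'a set \<Rightarrow> 'a tree \<Rightarrow> bool" where
  "conn_top S Leaf \<longleftrightarrow> S = {}"
| "conn_top S (Node l x r) \<longleftrightarrow> S = {} \<or>
     (x \<in> S \<and> S \<subseteq> insert x (set_tree l \<union> set_tree r)
      \<and> conn_top (S \<inter> set_tree l) l \<and> conn_top (S \<inter> set_tree r) r)"

(* top tree: a connected set of nodes containing the root (nodes are identified with their
   keys, which are distinct) *)
definition top_tree :: "'a set \<Rightarrow> 'a tree \<Rightarrow> bool" where
  "top_tree S T \<longleftrightarrow> T \<noteq> Leaf \<and> S \<noteq> {} \<and> conn_top S T"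

fun hanging :: "'a set \<Rightarrow> 'a tree \<Rightarrow> 'a tree set" where
  "hanging S Leaf = {}"
| "hanging S (Node l x r) = (if x \<in> S then hanging S l \<union> hanging S r else {Node l x r})"

definition block_boundary :: "'a tree \<Rightarrow> 'a tree \<Rightarrow> nat \<Rightarrow> bool" where
  "block_boundary T TA i \<longleftrightarrow>
     (let xs = inorder T; side = (\<lambda>j. xs ! j \<in> set_tree TA) in
        i = 0 \<or> i = length xs - 1 \<or> side (i - 1) \<noteq> side i \<or> side (i + 1) \<noteq> side i)"

definition bt_partition :: "'a tree \<Rightarrow> 'a set \<Rightarrow> 'a tree \<Rightarrow> 'a tree \<Rightarrow> bool" where
  "bt_partition T \<tau> TA TB \<longleftrightarrow>
     top_tree \<tau> T \<and> TA \<noteq> Leaf \<and> TB \<noteq> Leaf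
     \<and> distinct (inorder TA @ inorder TB)
     \<and> set_tree TA \<union> set_tree TB = set_tree T
     \<and> (\<exists>\<tau>a \<tau>b. top_tree \<tau>a TA \<and> top_tree \<tau>b TB \<and> \<tau> = \<tau>a \<union> \<tau>b
          \<and> hanging \<tau> T = hanging \<tau>a TA \<union> hanging \<tau>b TB)
     \<and> (\<forall>i < length (inorder T). block_boundary T TA i \<longrightarrow> inorder T ! i \<in> \<tau>)
     \<and> subseq (inorder TA) (inorder T) \<and> subseq (inorder TB) (inorder T)"

(* A BT partition sort algorithm is modelled as a (deterministic) strategy that, given the
   current BT, chooses the top tree \<tau> and the two output BTs.  psort_run alg T c means:
   running the algorithm on T is a valid BT partition sort execution using c accesses. *)
inductive psort_run :: "(nat tree \<Rightarrow> nat set \<times> nat tree \<times> nat tree) \<Rightarrow> nat tree \<Rightarrow> nat \<Rightarrow> bool"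
  for alg where
  stop: "size T = 1 \<Longrightarrow> psort_run alg T 0"
| split: "size T \<noteq> 1 \<Longrightarrow> alg T = (\<tau>, Ta, Tb) \<Longrightarrow> bt_partition T \<tau> Ta Tb \<Longrightarrow>
     (\<exists>k. (\<forall>x\<in>set_tree Ta. x < k) \<and> (\<forall>x\<in>set_tree Tb. k \<le> x)) \<Longrightarrow>
     psort_run alg Ta ca \<Longrightarrow> psort_run alg Tb cb \<Longrightarrow>
     psort_run alg T (card \<tau> + ca + cb)"

end

theory Submission
  imports Defs
begin

text \<open>Plot the positions of the input as columns and the split keys as rows, and mark every element
  touched by a split in the rows of the split key and of the two ends of the current key range. The
  resulting set has at most three points per access, contains the points of the permutation, and is
  arborally satisfied: LCAs in the current binary trees and block boundaries supply the required
  points. Reading the columns as times and the rows as keys, a satisfied set yields a BST algorithm that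
  keeps the tree heap-ordered by the next time at which a key is marked. The keys marked at the
  current time form a top tree, which is rearranged with a number of steps linear in its size by
  rotating it into a right spine and, in reverse, out of it again.\<close>

section \<open>Top trees and BT partitions\<close>

text \<open>The binary trees of the sort are ordered by input position and the search tree by key,
  so there is no direct translation of one tree into the other; the point set is the only interface
  between them. Positions are supplied by one function \<open>pos\<close> for all trees of the run,
  since the orders of the outputs are subsequences of the order of the input. Satisfaction is
  required only at the corner with the smaller position, that is, at the earlier time: when a key is
  touched, all that matters is that it is touched again before its untouched neighbours are. The
  resulting algorithm is offline because its heap order looks into the future. The constant is 24 =
  3 * 8: three rows for each access, and eight steps for each marked key. A single key costs the
  sort nothing and yields no points, so it is handled separately.\<close>

definition pos_sorted :: "('a \<Rightarrow> 'b::linorder) \<Rightarrow> 'a tree \<Rightarrow> bool" where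
  "pos_sorted pos T \<longleftrightarrow> sorted_wrt (\<lambda>x y. pos x < pos y) (inorder T)"

lemma pos_sorted_Node:
  "pos_sorted pos (Node l x r) \<longleftrightarrow> pos_sorted pos l \<and> pos_sorted pos r
     \<and> (\<forall>y\<in>set_tree l. pos y < pos x) \<and> (\<forall>y\<in>set_tree r. pos x < pos y)
     \<and> (\<forall>y\<in>set_tree l. \<forall>z\<in>set_tree r. pos y < pos z)"
  by (auto simp: pos_sorted_def sorted_wrt_append)

lemma conn_top_subset: "conn_top S T \<Longrightarrow> S \<subseteq> set_tree T"
  by (cases T) auto

lemma conn_top_Un: "conn_top S T \<Longrightarrow> conn_top R T \<Longrightarrow> conn_top (S \<union> R) T"
proof (induction T arbitrary: S R)
  case (Node l x r)
  show ?case
  proof (cases "S = {} \<or> R = {}")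
    case False
    then show ?thesis using Node by (auto simp: Int_Un_distrib2)
  qed (use Node in auto)
qed simp

text \<open>Connectivity of a superset of a top tree is decided inside the hanging subtrees alone. A
  partition leaves these unchanged, so connectivity can be carried from \<open>T\<close> to an
  output.\<close>

lemma conn_top_hanging:
  assumes "conn_top (\<tau> \<inter> set_tree T) T" "\<tau> \<subseteq> \<rho>"
  shows "conn_top (\<rho> \<inter> set_tree T) T \<longleftrightarrow> (\<forall>H\<in>hanging \<tau> T. conn_top (\<rho> \<inter> set_tree H) H)"
  using assms
proof (induction T)
  case (Node l x r)
  have *: "(S \<inter> set_tree (Node l x r)) \<inter> set_tree l = S \<inter> set_tree l"
     "(S \<inter> set_tree (Node l x r)) \<inter> set_tree r = S \<inter> set_tree r" for S by auto
  show ?case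
  proof (cases "x \<in> \<tau>")
    case True
    then have "conn_top (\<tau> \<inter> set_tree l) l" "conn_top (\<tau> \<inter> set_tree r) r"
      using Node.prems(1) unfolding conn_top.simps * by auto
    moreover have "x \<in> \<rho> \<inter> set_tree (Node l x r)" using True Node.prems by auto
    then have "conn_top (\<rho> \<inter> set_tree (Node l x r)) (Node l x r) \<longleftrightarrow>
      conn_top (\<rho> \<inter> set_tree l) l \<and> conn_top (\<rho> \<inter> set_tree r) r"
      unfolding conn_top.simps * by auto
    ultimately show ?thesis using Node True by auto
  qed (simp del: conn_top.simps)
qed simp

text \<open>The witness is the lowest common ancestor of \<open>x\<close> and \<open>y\<close>: a
  top tree contains all ancestors of its elements, so it lies in both sets, and its position is
  between the two. The induction finds it as the first root that does not have both on the same
  side.\<close>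

lemma conn_top_meet:
  assumes "pos_sorted pos T" "conn_top \<sigma> T" "conn_top \<tau> T" "x \<in> \<sigma>" "y \<in> \<tau>" "pos x \<le> pos y"
  shows "\<exists>z\<in>\<sigma> \<inter> \<tau>. pos x \<le> pos z \<and> pos z \<le> pos y"
  using assms
proof (induction T arbitrary: \<sigma> \<tau>)
  case (Node l a r)
  have a: "a \<in> \<sigma>" "a \<in> \<tau>" and s: "\<sigma> \<subseteq> set_tree (Node l a r)" "\<tau> \<subseteq> set_tree (Node l a r)"
    using Node.prems by auto
  have so: "pos_sorted pos l" "pos_sorted pos r" "\<forall>y\<in>set_tree l. pos y < pos a"
    "\<forall>y\<in>set_tree r. pos a < pos y"
    using Node.prems(1) by (auto simp: pos_sorted_Node)
  have c: "conn_top (\<sigma> \<inter> set_tree l) l" "conn_top (\<sigma> \<inter> set_tree r) r"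
     "conn_top (\<tau> \<inter> set_tree l) l" "conn_top (\<tau> \<inter> set_tree r) r" using Node.prems by auto
  consider "pos x \<le> pos a \<and> pos a \<le> pos y" | "pos y < pos a" | "pos a < pos x" by force
  then show ?case
  proof cases
    case 1 then show ?thesis using a by auto
  next
    case 2
    then have "pos x < pos a" using Node.prems(6) by auto
    with 2 have "x \<in> set_tree l" "y \<in> set_tree l" using s Node.prems(4,5) so by fastforce+
    then show ?thesis using Node.IH(1)[OF so(1) c(1,3)] Node.prems by auto
  next
    case 3
    then have "pos a < pos y" using Node.prems(6) by auto
    with 3 have "x \<in> set_tree r" "y \<in> set_tree r" using s Node.prems(4,5) so by fastforce+
    then show ?thesis using Node.IH(2)[OF so(2) c(2,4)] Node.prems by auto
  qed
qed simp

lemma sorted_wrt_subseq: "subseq xs ys \<Longrightarrow> sorted_wrt P ys \<Longrightarrow> sorted_wrt P xs"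
proof (induction rule: list_emb.induct)
  case (list_emb_Cons2 x y xs ys)
  then have "set xs \<subseteq> set ys" using set_nths_subset subseq_conv_nths by metis
  with list_emb_Cons2 show ?case by auto
qed auto

section \<open>The effect of a single partition\<close>

text \<open>Only \<open>block_boundary\<close> treats the outputs differently, and it merely
  compares sides of neighbours, which is invariant under complement. Later facts are therefore
  proved for \<open>A\<close> only.\<close>

lemma bt_partition_sym: "bt_partition T \<tau> A B \<Longrightarrow> bt_partition T \<tau> B A"
proof -
  assume bp: "bt_partition T \<tau> A B"
  have "block_boundary T A i" if "block_boundary T B i" "i < length (inorder T)" for i
  proof -
    have *: "inorder T ! j \<in> set_tree A \<longleftrightarrow> inorder T ! j \<notin> set_tree B"
      if "j < length (inorder T)" for j
    proof -
      have "inorder T ! j \<in> set_tree A \<union> set_tree B"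
        using nth_mem[OF that] bp by (auto simp: bt_partition_def)
      moreover have "set_tree A \<inter> set_tree B = {}"
        using bp by (auto simp: bt_partition_def)
      ultimately show ?thesis by blast
    qed
    show ?thesis
    proof (cases "i = 0 \<or> i = length (inorder T) - 1")
      case False
      then have "i < length (inorder T)" "i + 1 < length (inorder T)" "i - 1 < length (inorder T)"
        using that(2) by linarith+
      with * False that(1) show ?thesis
        unfolding block_boundary_def Let_def by metis
    qed (auto simp: block_boundary_def Let_def)
  qed
  moreover obtain a b where "top_tree a A \<and> top_tree b B \<and> \<tau> = a \<union> b
         \<and> hanging \<tau> T = hanging a A \<union> hanging b B" using bp by (auto simp: bt_partition_def)
  then have "\<exists>b a. top_tree b B \<and> top_tree a A \<and> \<tau> = b \<union> a
         \<and> hanging \<tau> T = hanging b B \<union> hanging a A" by blast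
  ultimately show ?thesis using bp unfolding bt_partition_def by auto
qed

lemma hanging_cong: "S \<inter> set_tree T = R \<inter> set_tree T \<Longrightarrow> hanging S T = hanging R T"
proof (induction T)
  case (Node l x r)
  then have "S \<inter> set_tree l = R \<inter> set_tree l" "S \<inter> set_tree r = R \<inter> set_tree r"
    "x \<in> S \<longleftrightarrow> x \<in> R" by auto
  with Node show ?case by simp
qed simp

text \<open>The last fact drives the inductions over a run: an earlier top tree \<sigma>, enlarged
  by the touched elements, is still a top tree after restriction to an output. Its connectivity
  passes from \<open>T\<close> down to the subtrees hanging from \<tau>; those that occur in
  \<open>A\<close> are among them, and there it is assembled again.\<close>

lemma bt_partition_facts:
  assumes bp: "bt_partition T \<tau> A B" and so: "pos_sorted pos T"
  shows "conn_top \<tau> T" "conn_top (\<tau> \<inter> set_tree A) A" "\<tau> \<inter> set_tree A \<noteq> {}"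
    "set_tree T = set_tree A \<union> set_tree B" "set_tree A \<inter> set_tree B = {}" "pos_sorted pos A"
    "\<And>\<sigma>. conn_top \<sigma> T \<Longrightarrow> conn_top ((\<sigma> \<union> \<tau>) \<inter> set_tree A) A"
proof -
  obtain a b where ab: "top_tree a A" "top_tree b B" "\<tau> = a \<union> b"
    "hanging \<tau> T = hanging a A \<union> hanging b B" using bp unfolding bt_partition_def by blast
  show disj: "set_tree A \<inter> set_tree B = {}" and "set_tree T = set_tree A \<union> set_tree B"
    using bp by (auto simp: bt_partition_def)
  have a: "a = \<tau> \<inter> set_tree A"
    using ab disj conn_top_subset[of a A] conn_top_subset[of b B] by (auto simp: top_tree_def)
  show t: "conn_top \<tau> T" using bp by (auto simp: bt_partition_def top_tree_def)
  show ta: "conn_top (\<tau> \<inter> set_tree A) A" "\<tau> \<inter> set_tree A \<noteq> {}"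
    using ab(1) unfolding a top_tree_def by simp_all
  have "subseq (inorder A) (inorder T)" using bp by (simp add: bt_partition_def)
  then show "pos_sorted pos A" using so sorted_wrt_subseq unfolding pos_sorted_def by blast
  fix \<sigma> assume s: "conn_top \<sigma> T"
  have ht: "hanging \<tau> A \<subseteq> hanging \<tau> T"
    using ab(4) hanging_cong[of a A \<tau>] a by blast
  have "(\<sigma> \<union> \<tau>) \<inter> set_tree T = \<sigma> \<union> \<tau>" "\<tau> \<inter> set_tree T = \<tau>"
    using conn_top_subset[OF s] conn_top_subset[OF t] by auto
  then have "\<forall>H\<in>hanging \<tau> T. conn_top ((\<sigma> \<union> \<tau>) \<inter> set_tree H) H"
    using conn_top_hanging[of \<tau> T "\<sigma> \<union> \<tau>"] t conn_top_Un[OF s t] by auto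
  then show "conn_top ((\<sigma> \<union> \<tau>) \<inter> set_tree A) A"
    using conn_top_hanging[of \<tau> A "\<sigma> \<union> \<tau>"] ta ht by auto
qed

lemma bt_partition_switch:
  assumes bp: "bt_partition T \<tau> A B" and so: "pos_sorted pos T"
    and x: "x \<in> set_tree A" and y: "y \<in> set_tree B" and xy: "pos x < pos y"
  shows "\<exists>b\<in>\<tau> \<inter> set_tree A. \<exists>b'\<in>\<tau> \<inter> set_tree B. pos x \<le> pos b \<and> pos b < pos b' \<and> pos b' \<le> pos y"
proof -
  let ?xs = "inorder T"
  note f = bt_partition_facts[OF bp so]
  have lt: "pos (?xs ! i) < pos (?xs ! j)" if "i < j" "j < length ?xs" for i j
    using so that by (auto simp: pos_sorted_def sorted_wrt_iff_nth_less)
  have le: "pos (?xs ! i) \<le> pos (?xs ! j)" if "i \<le> j" "j < length ?xs" for i j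
    using lt[of i j] that by (cases "i = j") auto
  obtain i j where ij: "i < length ?xs" "x = ?xs ! i" "j < length ?xs" "y = ?xs ! j"
    using x y f(4) by (metis UnCI in_set_conv_nth set_inorder)
  have "i < j" using le[of j i] ij xy by (meson leD not_le_imp_less)
  \<comment> \<open>The first element after \<open>x\<close> that goes to \<open>B\<close> starts a
    block and its predecessor ends one, so both are boundaries and hence touched.\<close>
  define m where "m = (LEAST m. i < m \<and> ?xs ! m \<in> set_tree B)"
  have m: "i < m" "?xs ! m \<in> set_tree B" "m \<le> j"
    unfolding m_def using LeastI[of "\<lambda>m. i < m \<and> ?xs ! m \<in> set_tree B" j] ij y \<open>i < j\<close>
    by (auto intro: Least_le)
  have mm: "?xs ! (m - 1) \<in> set_tree A"
  proof (cases "i = m - 1")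
    case True then show ?thesis using ij x by auto
  next
    case False
    then have "i < m - 1" using m by auto
    then have "?xs ! (m - 1) \<notin> set_tree B"
      using not_less_Least[of "m - 1" "\<lambda>m. i < m \<and> ?xs ! m \<in> set_tree B"] m by (auto simp: m_def)
    moreover have "?xs ! (m - 1) \<in> set_tree T"
      using m ij by (metis set_inorder nth_mem less_imp_diff_less order_le_less_trans)
    ultimately show ?thesis using f(4) by auto
  qed
  have mB: "?xs ! m \<notin> set_tree A" using m f(5) by auto
  have "block_boundary T A m" "block_boundary T A (m - 1)"
    using mm mB m by (auto simp: block_boundary_def Let_def)
  then have t: "?xs ! m \<in> \<tau>" "?xs ! (m - 1) \<in> \<tau>"
    using bp m ij unfolding bt_partition_def by (auto simp: less_imp_diff_less)
  have "pos x \<le> pos (?xs ! (m - 1))" "pos (?xs ! (m - 1)) < pos (?xs ! m)" "pos (?xs ! m) \<le> pos y"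
    using le[of i "m - 1"] lt[of "m - 1" m] le[of m j] m ij by auto
  then show ?thesis using t mm m by blast
qed

section \<open>The satisfied point set of a run\<close>

text \<open>An element touched by a split at \<open>k\<close> is recorded not only in row \<open>k\<close> but also in the rows of
  both ends of the current key range. With row \<open>k\<close> alone satisfaction may fail: a split at a key
  outside the rows under consideration can send away an ancestor that was touched earlier.\<close>

inductive touched :: "'a tree \<Rightarrow> int \<Rightarrow> int \<Rightarrow> ('a \<times> int) set \<Rightarrow> bool" where
  none: "lo < hi \<Longrightarrow> touched T lo hi {}"
| split: "bt_partition T \<tau> A B \<Longrightarrow> touched A lo k Pa \<Longrightarrow> touched B k hi Pb \<Longrightarrow>
     touched T lo hi (\<tau> \<times> {lo, k, hi} \<union> Pa \<union> Pb)"

lemma touched_less: "touched T lo hi P \<Longrightarrow> lo < hi"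
  by (induction rule: touched.induct) auto

lemma touched_bounds:
  assumes "touched T lo hi P" "(x, r) \<in> P"
  shows "x \<in> set_tree T \<and> lo \<le> r \<and> r \<le> hi"
  using assms
proof (induction rule: touched.induct)
  case (split T \<tau> A B lo k Pa hi Pb)
  have "\<tau> \<subseteq> set_tree T" "set_tree T = set_tree A \<union> set_tree B" using split.hyps(1)
    by (auto simp: bt_partition_def top_tree_def dest: conn_top_subset)
  then show ?case using split touched_less[OF split.hyps(2)] touched_less[OF split.hyps(3)]
    by fastforce
qed auto

text \<open>Rows are integers rather than naturals so that they can be negated. Reflection exchanges
  \<open>lo\<close> with \<open>hi\<close> and the output \<open>A\<close> with \<open>B\<close>,
  which turns every statement about higher rows into one about lower rows.\<close>

definition flip :: "('a \<times> int) set \<Rightarrow> ('a \<times> int) set" where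
  "flip P = {(x, r). (x, - r) \<in> P}"

lemma mem_flip [simp]: "(x, r) \<in> flip P \<longleftrightarrow> (x, - r) \<in> P"
  by (simp add: flip_def)

lemma flip_touched: "touched T lo hi P \<Longrightarrow> touched T (- hi) (- lo) (flip P)"
proof (induction rule: touched.induct)
  case (none lo hi T)
  have "flip {} = ({} :: ('a \<times> int) set)" by (auto simp: flip_def)
  then show ?case using touched.none[of "- hi" "- lo" T] none by auto
next
  case (split T \<tau> A B lo k Pa hi Pb)
  have "flip (\<tau> \<times> {lo, k, hi} \<union> Pa \<union> Pb) = \<tau> \<times> {- hi, - k, - lo} \<union> flip Pb \<union> flip Pa"
    by (auto simp: flip_def)
  then show ?case using touched.split[OF bt_partition_sym[OF split.hyps(1)] split.IH(2,1)] by simp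
qed

lemma pos_sorted_inj:
  assumes "pos_sorted pos T" "x \<in> set_tree T" "y \<in> set_tree T" "pos x = pos y"
  shows "x = y"
  using assms
proof (induction T)
  case (Node l a r)
  then show ?case by (fastforce simp: pos_sorted_Node)
qed simp

text \<open>If \<open>y\<close> was sent to the other output, there is a switch between
  \<open>x\<close> and \<open>y\<close>, and the block end on the side of \<open>x\<close> replaces
  \<open>y\<close>. It lies strictly right of \<open>x\<close> because it is touched and
  \<open>x\<close> is not.\<close>

lemma bt_partition_same_side:
  assumes bp: "bt_partition T \<tau> A B" and so: "pos_sorted pos T" and s: "conn_top \<sigma> T"
    and x: "x \<in> set_tree A" "x \<notin> \<tau>" and y: "y \<in> \<sigma>" "pos x < pos y"
  shows "\<exists>y'\<in>(\<sigma> \<union> \<tau>) \<inter> set_tree A. pos x < pos y' \<and> pos y' \<le> pos y"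
proof (cases "y \<in> set_tree A")
  case False
  note f = bt_partition_facts[OF bp so]
  have "y \<in> set_tree B" using False y conn_top_subset[OF s] f(4) by auto
  from bt_partition_switch[OF bp so x(1) this y(2)]
  obtain b where b: "b \<in> \<tau> \<inter> set_tree A" "pos x \<le> pos b" "pos b < pos y" by fastforce
  then have "pos x \<noteq> pos b" using pos_sorted_inj[OF f(6), of x b] x by auto
  then show ?thesis using b by (intro bexI[of _ b]) auto
qed (use y in auto)

text \<open>In the next two lemmas the elements of a top tree act as virtual points outside the rows of
  the range: just above row \<open>hi\<close> in the first, just below row \<open>lo\<close> in the second. This is the
  strengthening that lets the satisfaction of the point set be proved by induction.\<close>

lemma touched_above:
  assumes "touched T lo hi P" "pos_sorted pos T" "conn_top \<sigma> T"
    "(x, r) \<in> P" "y \<in> \<sigma>" "pos x < pos y" "x \<notin> \<sigma>"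
  shows "(\<exists>r'>r. (x, r') \<in> P) \<or> (\<exists>x'. (x', r) \<in> P \<and> pos x < pos x' \<and> pos x' \<le> pos y)"
  using assms
proof (induction arbitrary: \<sigma> y rule: touched.induct)
  case (split T \<tau> A B lo k Pa hi Pb)
  note fa = bt_partition_facts[OF split.hyps(1) split.prems(1)]
  note bs = bt_partition_sym[OF split.hyps(1)]
  note fb = bt_partition_facts[OF bs split.prems(1)]
  have k: "lo < k" "k < hi" using split.hyps touched_less by blast+
  note bnd = touched_bounds[OF split.hyps(2)] touched_bounds[OF split.hyps(3)]
  show ?case
  proof (cases "x \<in> \<tau>")
    case True
    show ?thesis
    \<comment> \<open>\<open>(x, hi)\<close> is a vertical witness unless \<open>r = hi\<close>. In
      that case the common ancestor of \<open>x\<close> and \<open>y\<close> lies in \<tau>, so it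
      is marked in row \<open>hi\<close>; it lies in \<sigma> too and so differs from
      \<open>x\<close>.\<close>
    proof (cases "r < hi")
      case False
      then have r: "r = hi" using split.prems(3) bnd k by fastforce
      obtain z where z: "z \<in> \<tau> \<inter> \<sigma>" "pos x \<le> pos z" "pos z \<le> pos y"
        using conn_top_meet[OF split.prems(1) fa(1) split.prems(2) True split.prems(4)]
          less_imp_le[OF split.prems(5)] by auto
      have "pos x \<noteq> pos z" using pos_sorted_inj[OF split.prems(1), of x z] z split.prems(6) True
          conn_top_subset[OF fa(1)] by blast
      then show ?thesis using z r by auto
    qed (use True in auto)
  next
    case False
    \<comment> \<open>The induction continues with the enlarged top tree. It offers a substitute for
      \<open>y\<close> on the side of \<open>x\<close>, and \<open>x\<close> stays outside
      it.\<close>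
    have xa: "x \<notin> (\<sigma> \<union> \<tau>) \<inter> set_tree S" for S using False split.prems by auto
    consider "(x, r) \<in> Pa" | "(x, r) \<in> Pb" using False split.prems(3) by auto
    then show ?thesis
    proof cases
      case 1
      then obtain y' where "y' \<in> (\<sigma> \<union> \<tau>) \<inter> set_tree A" "pos x < pos y'" "pos y' \<le> pos y"
        using bt_partition_same_side[OF split.hyps(1) split.prems(1,2) _ False split.prems(4,5)] bnd
        by blast
      then show ?thesis
        using split.IH(1)[OF fa(6) fa(7)[OF split.prems(2)] 1 _ _ xa, of y'] by fastforce
    next
      case 2
      then obtain y' where "y' \<in> (\<sigma> \<union> \<tau>) \<inter> set_tree B" "pos x < pos y'" "pos y' \<le> pos y"
        using bt_partition_same_side[OF bs split.prems(1,2) _ False split.prems(4,5)] bnd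
        by blast
      then show ?thesis
        using split.IH(2)[OF fb(6) fb(7)[OF split.prems(2)] 2 _ _ xa, of y'] by fastforce
    qed
  qed
qed simp

lemma touched_right_of_top:
  assumes "touched T lo hi P" "pos_sorted pos T" "conn_top \<sigma> T"
    "x \<in> \<sigma>" "(y, r) \<in> P" "pos x < pos y"
  shows "(\<exists>r'\<le>r. (x, r') \<in> P) \<or> (\<exists>x'\<in>\<sigma>. pos x < pos x' \<and> pos x' \<le> pos y)"
  using assms
proof (induction arbitrary: \<sigma> rule: touched.induct)
  case (split T \<tau> A B lo k Pa hi Pb)
  note fa = bt_partition_facts[OF split.hyps(1) split.prems(1)]
  note bs = bt_partition_sym[OF split.hyps(1)]
  note fb = bt_partition_facts[OF bs split.prems(1)]
  have k: "lo < k" "k < hi" using split.hyps touched_less by blast+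
  note bnd = touched_bounds[OF split.hyps(2)] touched_bounds[OF split.hyps(3)]
  show ?case
  proof (cases "x \<in> \<tau>")
    case True
    have "lo \<le> r" using split.prems(4) bnd k by fastforce
    then show ?thesis using True by auto
  next
    case False
    \<comment> \<open>The common ancestor of \<open>x\<close> and a touched \<open>b\<close> belongs
      to both \<sigma> and \<tau>. It cannot be \<open>x\<close>, which is untouched here, so it is
      the required element of \<sigma>.\<close>
    have meet: ?thesis if b: "b \<in> \<tau>" "pos x < pos b" "pos b \<le> pos y" for b
    proof -
      obtain z where z: "z \<in> \<sigma> \<inter> \<tau>" "pos x \<le> pos z" "pos z \<le> pos b"
        using conn_top_meet[OF split.prems(1,2) fa(1) split.prems(3) b(1)] less_imp_le[OF b(2)] by auto
      have "pos x \<noteq> pos z" using pos_sorted_inj[OF split.prems(1), of x z] z split.prems(3) False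
          conn_top_subset[OF split.prems(2)] by blast
      then show ?thesis using z b by force
    qed
    have xT: "x \<in> set_tree A \<union> set_tree B"
      using split.prems(3) conn_top_subset[OF split.prems(2)] fa(4) by auto
    have yT: "y \<in> \<tau> \<Longrightarrow> ?thesis" using meet split.prems by auto
    consider "y \<in> \<tau>" | "(y, r) \<in> Pa" "x \<in> set_tree A" | "(y, r) \<in> Pa" "x \<in> set_tree B" 
      | "(y, r) \<in> Pb" "x \<in> set_tree A" | "(y, r) \<in> Pb" "x \<in> set_tree B" 
      using split.prems(4) xT by auto
    then show ?thesis
    proof cases
      case 2
      from split.IH(1)[OF fa(6) fa(7)[OF split.prems(2)] _ 2(1) split.prems(5)] 2 split.prems(3)
      show ?thesis using meet by fastforce
    next
      case 3
      then show ?thesis using bt_partition_switch[OF bs split.prems(1), of x y] bnd split.prems meet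
        by (meson IntD1 order_le_less_trans)
    next
      case 4
      then show ?thesis using bt_partition_switch[OF split.hyps(1) split.prems(1), of x y] bnd split.prems meet
        by (meson IntD1 order_le_less_trans)
    next
      case 5
      from split.IH(2)[OF fb(6) fb(7)[OF split.prems(2)] _ 5(1) split.prems(5)] 5 split.prems(3)
      show ?thesis using meet by fastforce
    qed (use yT in auto)
  qed
qed simp

text \<open>The form of arboral satisfaction that asks for a further point on one of the two sides at the
  corner \<open>(x, r)\<close>; only the left corner of a pair is considered.\<close>

definition right_satisfied :: "('a \<Rightarrow> 'b::linorder) \<Rightarrow> ('a \<times> 'c::linorder) set \<Rightarrow> bool" where
  "right_satisfied pos P \<longleftrightarrow> (\<forall>x r y s. (x, r) \<in> P \<longrightarrow> (y, s) \<in> P \<longrightarrow> pos x < pos y \<longrightarrow> r \<noteq> s \<longrightarrow>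
     (\<exists>r'. (x, r') \<in> P \<and> r' \<noteq> r \<and> min r s \<le> r' \<and> r' \<le> max r s) \<or>
     (\<exists>x'. (x', r) \<in> P \<and> pos x < pos x' \<and> pos x' \<le> pos y))"

lemma right_satisfiedD:
  assumes "right_satisfied pos P" "(x, r) \<in> P" "(y, s) \<in> P" "pos x < pos y" "r \<noteq> s"
  shows "(\<exists>r'. (x, r') \<in> P \<and> r' \<noteq> r \<and> min r s \<le> r' \<and> r' \<le> max r s) \<or>
     (\<exists>x'. (x', r) \<in> P \<and> pos x < pos x' \<and> pos x' \<le> pos y)"
  using assms unfolding right_satisfied_def by blast

text \<open>Reflecting the rows swaps \<open>A\<close> and \<open>B\<close>, so of the pairs \<open>pts\<close> only those involving \<open>Pa\<close> need
  to be treated.\<close>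

lemma split_right_satisfied:
  fixes lo k hi :: int
  assumes bp: "bt_partition T \<tau> A B" and a: "touched A lo k Pa" and b: "touched B k hi Pb"
    and so: "pos_sorted pos T" and sat: "right_satisfied pos Pa"
    and P: "P = \<tau> \<times> {lo, k, hi} \<union> Pa \<union> Pb"
    and pts: "(x, r) \<in> Pa \<and> (y, s) \<in> P \<or> (x, r) \<in> \<tau> \<times> {lo, k, hi} \<and> (y, s) \<in> Pa"
    and xy: "pos x < pos y" and rs: "r \<noteq> s"
  shows "(\<exists>r'. (x, r') \<in> P \<and> r' \<noteq> r \<and> min r s \<le> r' \<and> r' \<le> max r s) \<or>
     (\<exists>x'. (x', r) \<in> P \<and> pos x < pos x' \<and> pos x' \<le> pos y)" (is "?V \<or> ?H")
proof -
  note fa = bt_partition_facts[OF bp so]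
  note bs = bt_partition_sym[OF bp]
  note fb = bt_partition_facts[OF bs so]
  have k: "lo < k" "k < hi" using a b touched_less by blast+
  note bnd = touched_bounds[OF a] touched_bounds[OF b]
  have PaP: "Pa \<subseteq> P" and tP: "\<And>z. z \<in> \<tau> \<Longrightarrow> (z, lo) \<in> P \<and> (z, k) \<in> P \<and> (z, hi) \<in> P"
    using P by auto
  have sub: "\<tau> \<subseteq> set_tree A \<union> set_tree B" using conn_top_subset[OF fa(1)] fa(4) by auto
  have V: ?thesis if "(x, r') \<in> P" "r' \<noteq> r" "r < s \<Longrightarrow> r \<le> r' \<and> r' \<le> s" "s < r \<Longrightarrow> s \<le> r' \<and> r' \<le> r" for r'
    using that rs by (intro disjI1 exI[of _ r']) (auto simp: min_def max_def)
  have Pa_le: "(z, r') \<in> Pa \<Longrightarrow> lo \<le> r' \<and> r' \<le> k" for z r' using bnd by blast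
  \<comment> \<open>A vertical witness from \<open>touched_above\<close> lies in \<open>Pa\<close>,
    hence not above row \<open>k\<close>; with \<open>k \<le> s\<close> it stays within the rows
    from \<open>r\<close> to \<open>s\<close>.\<close>
  have above: ?thesis if "(x, r) \<in> Pa" "y' \<in> \<tau> \<inter> set_tree A" "x \<notin> \<tau>" "pos x < pos y'" "pos y' \<le> pos y" "k \<le> s" for y'
  proof -
    have "x \<notin> \<tau> \<inter> set_tree A" using that by simp
    from touched_above[OF a fa(6) fa(2) that(1,2,4) this]
    show ?thesis
    proof (elim disjE exE conjE)
      fix r' assume r': "r < r'" "(x, r') \<in> Pa"
      then have "r' \<le> k" using Pa_le by blast
      then show ?thesis using V[of r'] r' PaP \<open>k \<le> s\<close> by auto
    next
      fix x' assume "(x', r) \<in> Pa" "pos x < pos x'" "pos x' \<le> pos y'"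
      then show ?thesis using PaP that(5) by (intro disjI2 exI[of _ x']) auto
    qed
  qed
  have both: ?thesis if "(x, r) \<in> Pa" "(y, s) \<in> Pa"
    using right_satisfiedD[OF sat that xy rs] PaP by blast
  show ?thesis
  proof (cases "(x, r) \<in> Pa")
    case xr: True
    then have x: "x \<in> set_tree A" "lo \<le> r" "r \<le> k" using bnd by auto
    have ys: "(y, s) \<in> P" using pts PaP by auto
    consider "(y, s) \<in> Pa" | "y \<in> \<tau>" "s \<in> {lo, k, hi}" | "(y, s) \<in> Pb" using ys P by auto
    then show ?thesis
    proof cases
      case 1 then show ?thesis using both xr by simp
    next
      case 2
      show ?thesis
      proof (cases "x \<in> \<tau>")
        case True
        then have "(x, s) \<in> P" using tP 2 by auto
        then show ?thesis using rs by auto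
      next
        case False
        obtain y' where y': "y' \<in> \<tau> \<inter> set_tree A" "pos x < pos y'" "pos y' \<le> pos y"
          using bt_partition_same_side[OF bp so fa(1) x(1) False 2(1) xy] by auto
        have nx: "x \<notin> \<tau> \<inter> set_tree A" using False by simp
        \<comment> \<open>In row \<open>k\<close> the touched \<open>y'\<close> is itself marked.
          Otherwise the other point lies either in row \<open>k\<close> or higher, or in the lowest
          row; the latter is the reflected situation.\<close>
        have "r = k \<or> r < k \<and> r < s \<or> s = lo \<and> s < r" using 2 rs x k by auto
        then consider "r = k" | "r < k" "r < s" | "s = lo" "s < r" by blast
        then show ?thesis
        proof cases
          case 1 then show ?thesis using tP y' by blast
        next
          case 2
          have "k \<le> s" using \<open>s \<in> {lo, k, hi}\<close> x \<open>r < s\<close> k by auto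
          then show ?thesis using above[OF xr y'(1) False y'(2,3)] by simp
        next
          case 3
          have "(x, - r) \<in> flip Pa" using xr by simp
          with touched_above[OF flip_touched[OF a] fa(6) fa(2) _ y'(1,2) nx] 
          have "(\<exists>r'. - r' > - r \<and> (x, r') \<in> Pa) \<or> (\<exists>x'. (x', r) \<in> Pa \<and> pos x < pos x' \<and> pos x' \<le> pos y')"
            by (metis add.inverse_inverse mem_flip)
          then show ?thesis
          proof (elim disjE exE conjE)
            fix r' assume r': "- r' > - r" "(x, r') \<in> Pa"
            then have "lo \<le> r'" using Pa_le by blast
            then show ?thesis using V[of r'] r' PaP 3 by auto
          next
            fix x' assume "(x', r) \<in> Pa" "pos x < pos x'" "pos x' \<le> pos y'"
            then show ?thesis using PaP y'(3) by (intro disjI2 exI[of _ x']) auto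
          qed
        qed
      qed
    next
      case 3
      then have y: "y \<in> set_tree B" "k \<le> s" using bnd by auto
      obtain b b' where bb: "b \<in> \<tau> \<inter> set_tree A" "b' \<in> \<tau> \<inter> set_tree B"
        "pos x \<le> pos b" "pos b < pos b'" "pos b' \<le> pos y"
        using bt_partition_switch[OF bp so x(1) y(1) xy] by auto
      show ?thesis
      proof (cases "r = k")
        case True
        then show ?thesis using tP[of b'] bb by (intro disjI2 exI[of _ b']) auto
      next
        case False
        show ?thesis
        proof (cases "x \<in> \<tau>")
          case True
          then show ?thesis using V[of k] tP[of x] x y False by auto
        next
          case nx: False
          have "pos x \<noteq> pos b" using pos_sorted_inj[OF fa(6), of x b] bb x nx by auto
          then have "pos x < pos b" using bb by auto
          then show ?thesis using above[OF xr bb(1) nx] bb y by auto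
        qed
      qed
    qed
  next
    case nxr: False
    then have ys: "(y, s) \<in> Pa" and x: "x \<in> \<tau>" "r \<in> {lo, k, hi}" using pts by auto
    then have y: "y \<in> set_tree A" "lo \<le> s" "s \<le> k" using bnd by auto
    \<comment> \<open>Here \<open>r\<close> is one of the three rows of this split, and every
      touched element is marked in all three.\<close>
    have h: ?H if "b \<in> \<tau>" "pos x < pos b" "pos b \<le> pos y" for b using that x(2) tP by blast
    show ?thesis
    proof (cases "x \<in> set_tree A")
      case False
      then have "x \<in> set_tree B" using sub x by blast
      from bt_partition_switch[OF bs so this y(1) xy] obtain b where
        "b \<in> \<tau>" "pos x < pos b" "pos b \<le> pos y" by fastforce
      then show ?thesis using h by blast
    next
      case True
      then have xt: "x \<in> \<tau> \<inter> set_tree A" using x by auto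
      \<comment> \<open>From row \<open>hi\<close>, the point \<open>(x, k)\<close> is on the way to
        \<open>s \<le> k\<close>. Rows \<open>lo\<close> and \<open>k\<close> are the two ends of
        the range of \<open>A\<close>, so \<open>x\<close> acts as a virtual point just outside it,
        and row \<open>k\<close> is the reflection of row \<open>lo\<close>. A vertical witness
        differs from \<open>(x, r)\<close> because it lies in \<open>Pa\<close> and
        \<open>(x, r)\<close> does not.\<close>
      consider "r = hi" | "r = lo" | "r = k" using x by auto
      then show ?thesis
      proof cases
        case 1 then show ?thesis using V[of k] tP[of x] x y k by auto
      next
        case 2
        from touched_right_of_top[OF a fa(6) fa(2) xt ys xy]
        consider r' where "r' \<le> s" "(x, r') \<in> Pa" | ?H using h by blast
        then show ?thesis
        proof cases
          case 1
          then have "r' \<noteq> r" using nxr by auto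
          moreover have "lo \<le> r'" using 1 Pa_le by blast
          ultimately show ?thesis using V[of r'] 1 2 PaP by auto
        qed simp
      next
        case 3
        have "(y, - s) \<in> flip Pa" using ys by simp
        from touched_right_of_top[OF flip_touched[OF a] fa(6) fa(2) xt this xy]
        consider r' where "r' \<le> - s" "(x, - r') \<in> Pa" | ?H using h by auto
        then show ?thesis
        proof cases
          case 1
          then have "- r' \<noteq> r" using nxr by auto
          moreover have "- r' \<le> k" using 1 Pa_le by blast
          ultimately show ?thesis using V[of "- r'"] 1 3 PaP by auto
        qed simp
      qed
    qed
  qed
qed

lemma right_satisfied_flip: "right_satisfied pos P \<Longrightarrow> right_satisfied pos (flip P)"
proof -
  assume s: "right_satisfied pos P"
  show ?thesis unfolding right_satisfied_def
  proof (intro allI impI)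
    fix x r y s assume "(x, r) \<in> flip P" "(y, s) \<in> flip P" and *: "pos x < pos y" "r \<noteq> s"
    then have "(x, - r) \<in> P" "(y, - s) \<in> P" by auto
    from right_satisfiedD[OF s this] *
    consider r' where "(x, r') \<in> P" "r' \<noteq> - r" "min (- r) (- s) \<le> r'" "r' \<le> max (- r) (- s)"
      | x' where "(x', - r) \<in> P" "pos x < pos x'" "pos x' \<le> pos y" by auto
    then show "(\<exists>r'. (x, r') \<in> flip P \<and> r' \<noteq> r \<and> min r s \<le> r' \<and> r' \<le> max r s) \<or>
       (\<exists>x'. (x', r) \<in> flip P \<and> pos x < pos x' \<and> pos x' \<le> pos y)"
    proof cases
      case 1
      then have "(x, - r') \<in> flip P \<and> - r' \<noteq> r \<and> min r s \<le> - r' \<and> - r' \<le> max r s" by auto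
      then show ?thesis by blast
    qed auto
  qed
qed

lemma touched_right_satisfied:
  assumes "touched T lo hi P" "pos_sorted pos T"
  shows "right_satisfied pos P"
  using assms
proof (induction rule: touched.induct)
  case (split T \<tau> A B lo k Pa hi Pb)
  note fa = bt_partition_facts[OF split.hyps(1) split.prems(1)]
  note bs = bt_partition_sym[OF split.hyps(1)]
  note fb = bt_partition_facts[OF bs split.prems(1)]
  note IH = split.IH(1)[OF fa(6)] split.IH(2)[OF fb(6)]
  define P where P: "P = \<tau> \<times> {lo, k, hi} \<union> Pa \<union> Pb"
  have fP: "flip P = \<tau> \<times> {- hi, - k, - lo} \<union> flip Pb \<union> flip Pa" unfolding P flip_def by auto
  show ?case unfolding P[symmetric] right_satisfied_def
  proof (intro allI impI)
    fix x r y s assume xr: "(x, r) \<in> P" and ys: "(y, s) \<in> P" and xy: "pos x < pos y" and rs: "r \<noteq> s"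
    let ?Q = "\<tau> \<times> {lo, k, hi}"
    have "(x, r) \<in> ?Q \<or> (x, r) \<in> Pa \<or> (x, r) \<in> Pb" "(y, s) \<in> ?Q \<or> (y, s) \<in> Pa \<or> (y, s) \<in> Pb"
      using xr ys unfolding P by blast+
    moreover have "(x, r) \<in> ?Q \<Longrightarrow> (x, - r) \<in> \<tau> \<times> {- hi, - k, - lo}" by auto
    moreover have "(x, r) \<in> ?Q \<Longrightarrow> x \<in> \<tau>" "(y, s) \<in> ?Q \<Longrightarrow> s \<in> {lo, k, hi}" by auto
    moreover have "(x, r) \<in> Pb \<Longrightarrow> (x, - r) \<in> flip Pb" "(y, s) \<in> Pb \<Longrightarrow> (y, - s) \<in> flip Pb"
      "(y, - s) \<in> flip P" using ys by auto
    \<comment> \<open>The second case is the first one after reflection. In the third, both points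
      stem from this split and \<open>(x, s)\<close> is marked as well.\<close>
    ultimately consider "(x, r) \<in> Pa \<and> (y, s) \<in> P \<or> (x, r) \<in> \<tau> \<times> {lo, k, hi} \<and> (y, s) \<in> Pa"
      | "(x, - r) \<in> flip Pb \<and> (y, - s) \<in> flip P \<or>
          (x, - r) \<in> \<tau> \<times> {- hi, - k, - lo} \<and> (y, - s) \<in> flip Pb"
      | "x \<in> \<tau>" "s \<in> {lo, k, hi}" using ys by metis
    then show "(\<exists>r'. (x, r') \<in> P \<and> r' \<noteq> r \<and> min r s \<le> r' \<and> r' \<le> max r s) \<or>
     (\<exists>x'. (x', r) \<in> P \<and> pos x < pos x' \<and> pos x' \<le> pos y)"
    proof cases
      case 1
      show ?thesis
        by (rule split_right_satisfied[OF split.hyps split.prems IH(1) P 1 xy rs])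
    next
      case 2
      have rs': "- r \<noteq> - s" using rs by simp
      from split_right_satisfied[OF bs flip_touched[OF split.hyps(3)] flip_touched[OF split.hyps(2)]
          split.prems right_satisfied_flip[OF IH(2)] fP 2 xy rs']
      consider r' where "(x, r') \<in> flip P" "r' \<noteq> - r" "min (- r) (- s) \<le> r'" "r' \<le> max (- r) (- s)"
        | x' where "(x', - r) \<in> flip P" "pos x < pos x'" "pos x' \<le> pos y" by auto
      then show ?thesis
      proof cases
        case 1
        then have "(x, - r') \<in> P \<and> - r' \<noteq> r \<and> min r s \<le> - r' \<and> - r' \<le> max r s" by auto
        then show ?thesis by blast
      qed auto
    next
      case 3
      then have "(x, s) \<in> P" unfolding P by auto
      then show ?thesis using rs by auto
    qed
  qed
qed (simp add: right_satisfied_def)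

section \<open>Rearranging top trees by rotations\<close>

definition reach :: "nat \<Rightarrow> 'a tree \<times> path \<Rightarrow> 'a tree \<times> path \<Rightarrow> bool" where
  "reach m s s' \<longleftrightarrow> (\<exists>c\<le>m. (bst_step ^^ c) s s')"

lemma reach_refl [simp]: "reach m s s"
  unfolding reach_def by (intro exI[of _ 0]) auto

lemma reach_step: "bst_step s s' \<Longrightarrow> reach 1 s s'"
  unfolding reach_def by (intro exI[of _ 1]) (auto simp del: One_nat_def simp: relpowp_1)

lemma reach_trans: "reach m s s' \<Longrightarrow> reach n s' s'' \<Longrightarrow> reach (m + n) s s''"
  unfolding reach_def by (meson add_mono relpowp_trans)

lemma reach_mono: "reach m s s' \<Longrightarrow> m \<le> n \<Longrightarrow> reach n s s'"
  unfolding reach_def by (meson order_trans)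

lemma reach_map:
  assumes "reach m s s'" "\<And>u v. bst_step u v \<Longrightarrow> bst_step (h u) (h v)"
  shows "reach m (h s) (h s')"
proof -
  have "(bst_step ^^ c) s s' \<Longrightarrow> (bst_step ^^ c) (h s) (h s')" for c
  proof (induction c arbitrary: s')
    case (Suc c)
    then obtain u where "(bst_step ^^ c) s u" "bst_step u s'" by (elim relpowp_Suc_E)
    then show ?case using Suc.IH assms(2) by (blast intro: relpowp_Suc_I)
  qed simp
  then show ?thesis using assms(1) unfolding reach_def by blast
qed

lemma bst_step_left: "bst_step (l, p) (l', p') \<Longrightarrow> bst_step (Node l x r, False # p) (Node l' x r, False # p')"
proof (induction "(l, p)" "(l', p')" rule: bst_step.induct)
  case to_parent
  then show ?case using bst_step.to_parent[of "False # p"] by auto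
next
  case (to_left l1 y r1)
  then show ?case using bst_step.to_left[of "Node l x r" "False # p"] by auto
next
  case (to_right l1 y r1)
  then show ?case using bst_step.to_right[of "Node l x r" "False # p"] by auto
next
  case rotate_up
  then show ?case using bst_step.rotate_up[of "False # p" "Node l x r"] by auto
qed

lemma bst_step_right: "bst_step (r, p) (r', p') \<Longrightarrow> bst_step (Node l x r, True # p) (Node l x r', True # p')"
proof (induction "(r, p)" "(r', p')" rule: bst_step.induct)
  case to_parent
  then show ?case using bst_step.to_parent[of "True # p"] by auto
next
  case (to_left l1 y r1)
  then show ?case using bst_step.to_left[of "Node l x r" "True # p"] by auto
next
  case (to_right l1 y r1)
  then show ?case using bst_step.to_right[of "Node l x r" "True # p"] by auto
next
  case rotate_up
  then show ?case using bst_step.rotate_up[of "True # p" "Node l x r"] by auto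
qed

lemma reach_left: "reach m (l, p) (l', p') \<Longrightarrow> reach m (Node l x r, False # p) (Node l' x r, False # p')"
  using reach_map[of m "(l, p)" "(l', p')" "\<lambda>(t, p). (Node t x r, False # p)"] bst_step_left by fastforce

lemma reach_right: "reach m (r, p) (r', p') \<Longrightarrow> reach m (Node l x r, True # p) (Node l x r', True # p')"
  using reach_map[of m "(r, p)" "(r', p')" "\<lambda>(t, p). (Node l x t, True # p)"] bst_step_right by fastforce

fun spine :: "('a tree \<times> 'a) list \<Rightarrow> 'a tree \<Rightarrow> 'a tree" where
  "spine [] R = R"
| "spine ((L, x) # ps) R = Node L x (spine ps R)"

text \<open>\<open>flat t ps R\<close>: removing some top tree of \<open>t\<close>, whose keys in order are those in \<open>ps\<close>, leaves
  the hanging subtrees in \<open>ps\<close> and \<open>R\<close>. Two trees with the same \<open>ps\<close> and \<open>R\<close> are thus rearrangements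
  of one top tree.\<close>

inductive flat :: "'a tree \<Rightarrow> ('a tree \<times> 'a) list \<Rightarrow> 'a tree \<Rightarrow> bool" where
  hang: "flat t [] t"
| node: "flat l ps L \<Longrightarrow> flat r qs R \<Longrightarrow> flat (Node l x r) (ps @ (L, x) # qs) R"

lemma flat_Nil: "flat t [] R \<Longrightarrow> R = t"
  by (erule flat.cases) auto

lemma flat_not_Leaf: "flat t ps R \<Longrightarrow> ps \<noteq> [] \<Longrightarrow> t \<noteq> Leaf"
  by (erule flat.cases) auto

lemma spine_append: "spine (ps @ qs) R = spine ps (spine qs R)"
  by (induction ps R rule: spine.induct) auto

lemma inorder_spine: "inorder (spine (ps @ (L, x) # qs) R) = inorder (spine ps L) @ x # inorder (spine qs R)"
  by (induction ps L rule: spine.induct) auto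

lemma flat_inorder: "flat t ps R \<Longrightarrow> inorder t = inorder (spine ps R)"
  by (induction rule: flat.induct) (auto simp: inorder_spine)

abbreviation right_path :: "nat \<Rightarrow> path" where
  "right_path n \<equiv> replicate n True"

lemma subtree_at_spine: "subtree_at (spine ps R) (right_path (length ps) @ p) = subtree_at R p"
  by (induction ps R rule: spine.induct) auto

lemma reach_spine:
  "reach m (t, p) (t', p') \<Longrightarrow>
    reach m (spine ps t, right_path (length ps) @ p) (spine ps t', right_path (length ps) @ p')"
proof (induction ps)
  case (Cons q ps)
  then show ?case using reach_right by (cases q) auto
qed simp

lemma reach_child:
  assumes "subtree_at t p = Node l x r" "(if d then r else l) \<noteq> Leaf"
  shows "reach 1 (t, p) (t, p @ [d])" "reach 1 (t, p @ [d]) (t, p)"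
  using bst_step.to_left[OF assms(1)] bst_step.to_right[OF assms(1)] assms(2)
    bst_step.to_parent[of "p @ [d]" t]
  by (cases d; auto intro!: reach_step[simplified])+

lemma reach_rotate:
  "reach 2 (Node (Node a x b) y c, []) (Node a x (Node b y c), [])"
  "reach 2 (Node a x (Node b y c), []) (Node (Node a x b) y c, [])"
proof -
  have "reach 1 (Node (Node a x b) y c, [False]) (Node a x (Node b y c), [])"
    using bst_step.rotate_up[of "[False]" "Node (Node a x b) y c"] by (intro reach_step) auto
  then show "reach 2 (Node (Node a x b) y c, []) (Node a x (Node b y c), [])"
    using reach_trans[of 1 "(Node (Node a x b) y c, [])" "(Node (Node a x b) y c, [False])" 1]
      reach_child(1)[of "Node (Node a x b) y c" "[]" "Node a x b" y c False] by (simp add: numeral_2_eq_2)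
  have "reach 1 (Node a x (Node b y c), [True]) (Node (Node a x b) y c, [])"
    using bst_step.rotate_up[of "[True]" "Node a x (Node b y c)"] by (intro reach_step) auto
  then show "reach 2 (Node a x (Node b y c), []) (Node (Node a x b) y c, [])"
    using reach_trans[of 1 "(Node a x (Node b y c), [])" "(Node a x (Node b y c), [True])" 1]
      reach_child(1)[of "Node a x (Node b y c)" "[]" a x "Node b y c" True] by (simp add: numeral_2_eq_2)
qed

text \<open>Each key is rotated onto the spine exactly once and the pointer never returns, which keeps the
  cost linear; running the walk backwards is equally cheap.\<close>

lemma flatten_left:
  assumes "flat l ps L"
  shows "reach (3 * length ps) (Node l x r, []) (spine ps (Node L x r), right_path (length ps)) \<and>
    reach (3 * length ps) (spine ps (Node L x r), right_path (length ps)) (Node l x r, [])"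
  using assms
proof (induction arbitrary: x r rule: flat.induct)
  case (node l ps L l' qs L' y)
  define u where "u = right_path (length ps)"
  define v where "v = right_path (length qs)"
  \<comment> \<open>Once \<open>y\<close> is rotated above \<open>x\<close>, both remaining tasks
    have the original form: \<open>l\<close> is flattened to the left of \<open>y\<close>, then
    \<open>l'\<close> to the left of \<open>x\<close>.\<close>
  let ?t = "spine ps (Node L y (Node l' x r))"
  have sp: "spine (ps @ (L, y) # qs) (Node L' x r) = spine ps (Node L y (spine qs (Node L' x r)))"
    "right_path (length (ps @ (L, y) # qs)) = u @ True # v"
    by (auto simp: spine_append u_def v_def replicate_add replicate_app_Cons_same)
  note r1 = conjunct1[OF node.IH(1)[of y "Node l' x r", folded u_def]]
    conjunct2[OF node.IH(1)[of y "Node l' x r", folded u_def]]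
  have "subtree_at ?t u = Node L y (Node l' x r)"
    using subtree_at_spine[of ps _ "[]"] unfolding u_def by simp
  note r2 = reach_child[OF this, of True, simplified, folded One_nat_def]
  have r3: "reach (3 * length qs) (?t, u @ [True]) (spine ps (Node L y (spine qs (Node L' x r))), u @ True # v)"
     "reach (3 * length qs) (spine ps (Node L y (spine qs (Node L' x r))), u @ True # v) (?t, u @ [True])"
    unfolding u_def v_def by (intro reach_spine reach_right; use node.IH(2)[of x r] in simp)+
  \<comment> \<open>Three steps are charged to \<open>y\<close>: two to descend to it and rotate it
    up, one to move past it on the spine.\<close>
  have "reach (2 + 3 * length ps + 1 + 3 * length qs) (Node (Node l y l') x r, [])
     (spine ps (Node L y (spine qs (Node L' x r))), u @ True # v)"
    by (rule reach_trans[OF reach_trans[OF reach_trans[OF reach_rotate(1) r1(1)] r2(1)] r3(1)])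
  moreover have "reach (3 * length qs + 1 + 3 * length ps + 2)
     (spine ps (Node L y (spine qs (Node L' x r))), u @ True # v) (Node (Node l y l') x r, [])"
    by (rule reach_trans[OF reach_trans[OF reach_trans[OF r3(2) r2(2)] r1(2)] reach_rotate(2)])
  ultimately show ?case unfolding sp by (auto intro: reach_mono)
qed auto

text \<open>Unlike in \<open>flatten_left\<close>, no key is known to follow on the right, and
  \<open>R\<close> may be a leaf, on which the pointer cannot stand. The walk therefore ends on the
  last key of the spine, at depth \<open>length ps - 1\<close>.\<close>

lemma flatten:
  assumes "flat t ps R" "ps \<noteq> []"
  shows "reach (3 * length ps) (t, []) (spine ps R, right_path (length ps - 1)) \<and>
    reach (3 * length ps) (spine ps R, right_path (length ps - 1)) (t, [])"
  using assms
proof (induction rule: flat.induct)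
  case (node l ps L r qs R x)
  note g = conjunct1[OF flatten_left[OF node.hyps(1), of x r]]
    conjunct2[OF flatten_left[OF node.hyps(1), of x r]]
  show ?case
  proof (cases "qs = []")
    case True
    then have "R = r" using node.hyps(2) flat_Nil by auto
    then show ?thesis using g True by (auto simp: spine_append intro: reach_mono)
  next
    case False
    define u where "u = right_path (length ps)"
    define v where "v = right_path (length qs - 1)"
    let ?t = "spine ps (Node L x r)"
    have sp: "spine (ps @ (L, x) # qs) R = spine ps (Node L x (spine qs R))"
      "right_path (length (ps @ (L, x) # qs) - 1) = u @ True # v"
      using False by (cases qs; auto simp: spine_append u_def v_def replicate_add replicate_app_Cons_same)+
    have "subtree_at ?t u = Node L x r"
      using subtree_at_spine[of ps _ "[]"] unfolding u_def by simp
    note r2 = reach_child[OF this, of True, simplified, folded One_nat_def, OF flat_not_Leaf[OF node.hyps(2) False]]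
    have r3: "reach (3 * length qs) (?t, u @ [True]) (spine ps (Node L x (spine qs R)), u @ True # v)"
       "reach (3 * length qs) (spine ps (Node L x (spine qs R)), u @ True # v) (?t, u @ [True])"
      unfolding u_def v_def by (intro reach_spine reach_right; use node.IH(2) False in simp)+
    have "reach (3 * length ps + 1 + 3 * length qs) (Node l x r, [])
       (spine ps (Node L x (spine qs R)), u @ True # v)"
      by (rule reach_trans[OF reach_trans[OF g(1)[folded u_def] r2(1)] r3(1)])
    moreover have "reach (3 * length qs + 1 + 3 * length ps)
       (spine ps (Node L x (spine qs R)), u @ True # v) (Node l x r, [])"
      by (rule reach_trans[OF reach_trans[OF r3(2) r2(2)] g(2)[folded u_def]])
    ultimately show ?thesis unfolding sp by (auto intro: reach_mono)
  qed
qed simp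

lemma walk:
  assumes "flat t ps R" "q \<in> snd ` set ps"
  shows "\<exists>p. reach (length ps) (t, []) (t, p) \<and> reach (length ps) (t, p) (t, []) \<and> key_at (t, p) = Some q"
  using assms
proof (induction rule: flat.induct)
  case (node l ps L r qs R x)
  have child: ?case if "reach m (t', []) (t', p)" "reach m (t', p) (t', [])" "key_at (t', p) = Some q"
    "t' = (if d then r else l)" "m \<le> length ps + length qs" for m t' p d
  proof -
    have ne: "t' \<noteq> Leaf" using that(3) by (cases p) auto
    have 1: "reach 1 (Node l x r, []) (Node l x r, [d])" "reach 1 (Node l x r, [d]) (Node l x r, [])"
      using reach_child[of "Node l x r" "[]" l x r d] ne that(4) by auto
    have 2: "reach m (Node l x r, [d]) (Node l x r, d # p)" "reach m (Node l x r, d # p) (Node l x r, [d])"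
      using that reach_left[of m l] reach_right[of m r] by (cases d; auto)+
    have "reach (1 + m) (Node l x r, []) (Node l x r, d # p)" "reach (m + 1) (Node l x r, d # p) (Node l x r, [])"
      using reach_trans 1 2 by blast+
    then show ?thesis using that(3-5)
      by (intro exI[of _ "d # p"]) (auto intro: reach_mono split: if_splits)
  qed
  consider "q = x" | "q \<in> snd ` set ps" | "q \<in> snd ` set qs" using node.prems by auto
  then show ?case
  proof cases
    case 1 then show ?thesis by (intro exI[of _ "[]"]) auto
  next
    case 2 then show ?thesis using node.IH(1) child[of "length ps" l _ False] by auto
  next
    case 3 then show ?thesis using node.IH(2) child[of "length qs" r _ True] by auto
  qed
qed simp

text \<open>Both trees can be transformed into the same spine, so the walk for \<open>t'\<close> is
  run backwards after that for \<open>t\<close>. Per key this costs 3 + 3 steps, and visiting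
  \<open>q\<close> and returning to the root beforehand adds 1 + 1.\<close>

lemma search_flat:
  assumes "flat t ps R" "flat t' ps R" "q \<in> snd ` set ps"
  shows "\<exists>c\<le>8 * length ps. search t q t' c"
proof -
  have ne: "ps \<noteq> []" using assms(3) by auto
  obtain p where p: "reach (length ps) (t, []) (t, p)" "reach (length ps) (t, p) (t, [])"
    "key_at (t, p) = Some q" using walk[OF assms(1,3)] by blast
  have "reach (3 * length ps + 3 * length ps) (t, []) (t', [])"
    using reach_trans flatten[OF assms(1) ne] flatten[OF assms(2) ne] by blast
  from reach_trans[OF p(2) this] obtain c2 where "c2 \<le> 7 * length ps" "(bst_step ^^ c2) (t, p) (t', [])"
    unfolding reach_def by auto
  moreover obtain c1 where "c1 \<le> length ps" "(bst_step ^^ c1) (t, []) (t, p)"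
    using p(1) unfolding reach_def by auto
  ultimately have "search t q t' (c1 + c2)" "c1 + c2 \<le> 8 * length ps"
    using p(3) unfolding search_def by (blast, linarith)
  then show ?thesis by blast
qed

section \<open>Serving a satisfied point set\<close>

fun heap :: "('a \<Rightarrow> 'b::linorder) \<Rightarrow> 'a tree \<Rightarrow> bool" where
  "heap f Leaf \<longleftrightarrow> True"
| "heap f (Node l x r) \<longleftrightarrow> (\<forall>y\<in>set_tree l \<union> set_tree r. f x \<le> f y) \<and> heap f l \<and> heap f r"

lemma heap_cong: "heap f t \<Longrightarrow> (\<And>x. x \<in> set_tree t \<Longrightarrow> f x = g x) \<Longrightarrow> heap g t"
proof (induction t)
  case (Node l x r)
  have "g x \<le> g y" if "y \<in> set_tree l \<union> set_tree r" for y
  proof -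
    have "f x \<le> f y" using Node.prems(1) that by simp
    moreover have "f x = g x" "f y = g y" using Node.prems(2) that by auto
    ultimately show ?thesis by metis
  qed
  moreover have "heap g l" "heap g r" using Node.IH Node.prems by simp_all
  ultimately show ?case by simp
qed simp

definition hangs :: "('a tree \<times> 'a) list \<Rightarrow> 'a tree \<Rightarrow> 'a tree set" where
  "hangs ps R = insert R (fst ` set ps)"

text \<open>In heap order a parent has no larger value than its children, so the keys of value at
  most \<open>m\<close> are closed under ancestors and form a top tree.\<close>

lemma heap_flat:
  assumes "heap f t"
  shows "\<exists>ps R. flat t ps R \<and> snd ` set ps = {x \<in> set_tree t. f x \<le> m} \<and>
    (\<forall>L\<in>hangs ps R. heap f L \<and> (\<forall>y\<in>set_tree L. m < f y))"
  using assms
proof (induction t)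
  case Leaf
  show ?case by (intro exI[of _ "[]"] exI[of _ Leaf]) (simp add: hangs_def flat.hang)
next
  case (Node l x r)
  show ?case
  proof (cases "f x \<le> m")
    case True
    have hs: "heap f l" "heap f r" using Node.prems by simp_all
    from Node.IH(1)[OF hs(1)] obtain ps where "\<exists>R. flat l ps R \<and> snd ` set ps = {x \<in> set_tree l. f x \<le> m} \<and>
      (\<forall>L\<in>hangs ps R. heap f L \<and> (\<forall>y\<in>set_tree L. m < f y))" ..
    then obtain L where "flat l ps L \<and> snd ` set ps = {x \<in> set_tree l. f x \<le> m} \<and>
      (\<forall>L\<in>hangs ps L. heap f L \<and> (\<forall>y\<in>set_tree L. m < f y))" ..
    then have l: "flat l ps L" "snd ` set ps = {x \<in> set_tree l. f x \<le> m}"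
      "\<forall>L\<in>hangs ps L. heap f L \<and> (\<forall>y\<in>set_tree L. m < f y)" by simp_all
    from Node.IH(2)[OF hs(2)] obtain qs where "\<exists>R. flat r qs R \<and> snd ` set qs = {x \<in> set_tree r. f x \<le> m} \<and>
      (\<forall>L\<in>hangs qs R. heap f L \<and> (\<forall>y\<in>set_tree L. m < f y))" ..
    then obtain R where "flat r qs R \<and> snd ` set qs = {x \<in> set_tree r. f x \<le> m} \<and>
      (\<forall>L\<in>hangs qs R. heap f L \<and> (\<forall>y\<in>set_tree L. m < f y))" ..
    then have r: "flat r qs R" "snd ` set qs = {x \<in> set_tree r. f x \<le> m}"
      "\<forall>L\<in>hangs qs R. heap f L \<and> (\<forall>y\<in>set_tree L. m < f y)" by simp_all
    have "flat (Node l x r) (ps @ (L, x) # qs) R" by (rule flat.node[OF l(1) r(1)])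
    moreover have "hangs (ps @ (L, x) # qs) R = hangs ps L \<union> hangs qs R" by (auto simp: hangs_def)
    moreover have "snd ` set (ps @ (L, x) # qs) = {y \<in> set_tree (Node l x r). f y \<le> m}"
    proof -
      have "snd ` set (ps @ (L, x) # qs) = insert x (snd ` set ps \<union> snd ` set qs)" by auto
      also have "\<dots> = {y \<in> set_tree (Node l x r). f y \<le> m}" unfolding l(2) r(2) using True by auto
      finally show ?thesis .
    qed
    ultimately show ?thesis using l(3) r(3)
      by (intro exI[of _ "ps @ (L, x) # qs"] exI[of _ R]) (simp only: ball_Un simp_thms)
  next
    case False
    have above: "m < f y" if "y \<in> set_tree (Node l x r)" for y
    proof -
      have "f x \<le> f y" using Node.prems that by auto
      then show ?thesis using False by simp
    qed
    then have "\<not> f y \<le> m" if "y \<in> set_tree (Node l x r)" for y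
      using that by (simp only: not_le)
    then have "{y \<in> set_tree (Node l x r). f y \<le> m} = {}" by blast
    then have "snd ` set [] = {y \<in> set_tree (Node l x r). f y \<le> m}"
      "\<forall>L\<in>hangs [] (Node l x r). heap f L \<and> (\<forall>y\<in>set_tree L. m < f y)"
      using Node.prems above by (simp_all add: hangs_def del: heap.simps tree.set)
    then show ?thesis using flat.hang by (intro exI conjI)
  qed
qed

section \<open>Heap orders on rearranged top trees\<close>

fun first_hang :: "('a tree \<times> 'a) list \<Rightarrow> 'a tree \<Rightarrow> 'a tree" where
  "first_hang [] R = R"
| "first_hang ((L, x) # ps) R = L"

text \<open>\<open>L\<close> and \<open>first_hang ps R\<close> are the gaps on the two sides of
  \<open>x\<close>. However the top tree is rearranged, the parent of a hanging subtree is one of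
  the two keys next to its gap, so this is what heap order needs between top keys and hanging
  subtrees.\<close>

fun dominates :: "('a \<Rightarrow> 'b::linorder) \<Rightarrow> ('a tree \<times> 'a) list \<Rightarrow> 'a tree \<Rightarrow> bool" where
  "dominates g [] R \<longleftrightarrow> True"
| "dominates g ((L, x) # ps) R \<longleftrightarrow>
     (\<forall>y\<in>set_tree L \<union> set_tree (first_hang ps R). g x \<le> g y) \<and> dominates g ps R"

lemma dominates_append:
  "dominates g (ps @ (L, x) # qs) R \<Longrightarrow> dominates g ps L \<and> dominates g qs R"
proof (induction ps L rule: spine.induct)
  case (2 M z ps L)
  have "first_hang (ps @ (L, x) # qs) R = first_hang ps L" by (cases ps) auto
  with 2 show ?case by auto
qed simp

lemma dominates_min:
  "dominates g ps R \<Longrightarrow> ps \<noteq> [] \<Longrightarrow> y \<in> set (inorder (spine ps R)) \<Longrightarrow> \<exists>z\<in>snd ` set ps. g z \<le> g y"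
proof (induction ps R rule: spine.induct)
  case (2 L x ps R)
  then show ?case by (cases "ps = []") auto
qed simp

text \<open>The usual treap construction: a top key of least value becomes the root and the two
  parts of the list are treated recursively. By \<open>dominates_min\<close> no key of a hanging
  subtree has a smaller value.\<close>

lemma heap_unflat:
  assumes "dominates g ps R" "\<forall>L\<in>hangs ps R. heap g L"
  shows "\<exists>t. flat t ps R \<and> heap g t"
  using assms
proof (induction ps arbitrary: R rule: measure_induct_rule[of length])
  case (less ps)
  show ?case
  proof (cases "ps = []")
    case True
    then show ?thesis using less.prems by (auto simp: hangs_def intro: flat.intros)
  next
    case False
    have "Min ((g \<circ> snd) ` set ps) \<in> (g \<circ> snd) ` set ps" using False by (intro Min_in) auto
    then obtain L x where x: "(L, x) \<in> set ps" "g x = Min ((g \<circ> snd) ` set ps)" by auto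
    then have min: "g x \<le> g z" if "z \<in> snd ` set ps" for z
      unfolding x(2) using that by (intro Min_le) auto
    obtain ps1 ps2 where ps: "ps = ps1 @ (L, x) # ps2" using split_list[OF x(1)] by blast
    have d: "dominates g ps1 L" "dominates g ps2 R" using dominates_append[of g ps1 L x ps2 R] less.prems(1) ps by simp_all
    have h: "\<forall>L\<in>hangs ps1 L. heap g L" "\<forall>L\<in>hangs ps2 R. heap g L"
      using less.prems(2) ps by (auto simp: hangs_def)
    obtain l where l: "flat l ps1 L" "heap g l" using less.IH[OF _ d(1) h(1)] ps by auto
    obtain r where r: "flat r ps2 R" "heap g r" using less.IH[OF _ d(2) h(2)] ps by auto
    have f: "flat (Node l x r) ps R" unfolding ps by (rule flat.node[OF l(1) r(1)])
    have "g x \<le> g y" if "y \<in> set_tree (Node l x r)" for y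
    proof -
      have "y \<in> set (inorder (spine ps R))" using that flat_inorder[OF f] by (metis set_inorder)
      then show ?thesis using dominates_min[OF less.prems(1) False] min by force
    qed
    then have "heap g (Node l x r)" using l r by auto
    then show ?thesis using f by blast
  qed
qed

lemma set_spine_keys: "snd ` set ps \<subseteq> set (inorder (spine ps R))"
  by (induction ps R rule: spine.induct) auto

lemma first_hang_less:
  assumes "sorted_wrt (<) (inorder (spine ps R))" "y \<in> set_tree (first_hang ps R)" "w \<in> snd ` set ps"
  shows "y < (w::'a::linorder)"
proof (cases ps)
  case (Cons q qs)
  obtain L x where q: "q = (L, x)" by fastforce
  show ?thesis using set_spine_keys[of qs R] assms Cons q by (auto simp: sorted_wrt_append)
qed (use assms in auto)

lemma set_first_hang: "set_tree (first_hang ps R) \<subseteq> set (inorder (spine ps R))"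
  by (induction ps R rule: spine.induct) auto

text \<open>\<open>K\<close> stands for all top keys. The induction removes keys from the left end
  of the list while \<open>K\<close> stays fixed, so the second assumption also allows members of
  \<open>K\<close> to the left of the remaining spine.\<close>

lemma sorted_dominates:
  fixes K :: "'a::linorder set"
  assumes "sorted_wrt (<) (inorder (spine ps R))"
    and "\<forall>w\<in>K. w \<in> snd ` set ps \<or> (\<forall>v\<in>set (inorder (spine ps R)). w < v)"
    and "\<And>z y. z \<in> snd ` set ps \<Longrightarrow> z \<noteq> y \<Longrightarrow> \<forall>w\<in>K. w \<noteq> z \<longrightarrow> \<not> (min z y \<le> w \<and> w \<le> max z y) \<Longrightarrow> g z \<le> g y"
  shows "dominates g ps R"
  using assms
proof (induction ps R rule: spine.induct)
  case (2 L z ps R)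
  have so: "sorted_wrt (<) (inorder (spine ps R))" "\<forall>v\<in>set (inorder (spine ps R)). z < v" "\<forall>v\<in>set_tree L. v < z"
    using "2.prems"(1) by (auto simp: sorted_wrt_append)
  have keys: "z < w" if "w \<in> snd ` set ps" for w using so(2) set_spine_keys[of ps R] that by blast
  have "g z \<le> g y" if y: "y \<in> set_tree L" for y
  proof (rule "2.prems"(3))
    show "z \<noteq> y" using y so by auto
    show "\<forall>w\<in>K. w \<noteq> z \<longrightarrow> \<not> (min z y \<le> w \<and> w \<le> max z y)"
    proof (intro ballI impI notI)
      fix w assume w: "w \<in> K" "w \<noteq> z" "min z y \<le> w \<and> w \<le> max z y"
      have yz: "y < z" using y so(3) by blast
      then have yw: "y \<le> w" "w < z" using w yz by (auto simp: min_absorb2 max_absorb1 less_le)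
      have "w \<in> snd ` set ((L, z) # ps) \<or> w < y" using "2.prems"(2) w(1) y by auto
      moreover have "snd ` set ((L, z) # ps) = insert z (snd ` set ps)" by simp
      ultimately show False using yw keys[of w] w(2) by (metis insert_iff leD less_asym)
    qed
  qed auto
  moreover have "g z \<le> g y" if y: "y \<in> set_tree (first_hang ps R)" for y
  proof (rule "2.prems"(3))
    have zy: "z < y" using y so(2) set_first_hang[of ps R] by blast
    then show "z \<noteq> y" by auto
    show "\<forall>w\<in>K. w \<noteq> z \<longrightarrow> \<not> (min z y \<le> w \<and> w \<le> max z y)"
    proof (intro ballI impI notI)
      fix w assume w: "w \<in> K" "w \<noteq> z" "min z y \<le> w \<and> w \<le> max z y"
      then have zw: "z < w" "w \<le> y" using zy by (auto simp: min_absorb1 max_absorb2 less_le)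
      have "w \<in> snd ` set ((L, z) # ps) \<or> w < z" using "2.prems"(2) w(1) by auto
      moreover have "snd ` set ((L, z) # ps) = insert z (snd ` set ps)" by simp
      ultimately show False using zw first_hang_less[OF so(1) y, of w]
        by (metis insert_iff leD less_asym less_irrefl)
    qed
  qed auto
  moreover have "dominates g ps R"
  proof (rule "2.IH"[OF so(1)])
    show "\<forall>w\<in>K. w \<in> snd ` set ps \<or> (\<forall>v\<in>set (inorder (spine ps R)). w < v)"
      using "2.prems"(2) so(2) by auto
    show "g z' \<le> g y" if "z' \<in> snd ` set ps" "z' \<noteq> y" "\<forall>w\<in>K. w \<noteq> z' \<longrightarrow> \<not> (min z' y \<le> w \<and> w \<le> max z' y)" for z' y
      using "2.prems"(3)[of z' y] that by auto
  qed
  ultimately show ?case by auto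
qed simp

text \<open>The value is at least \<open>n\<close> if \<open>k\<close> is not touched at a time from \<open>i\<close> to \<open>n - 1\<close>.\<close>

definition next_touch :: "(nat \<times> 'a) set \<Rightarrow> nat \<Rightarrow> nat \<Rightarrow> 'a \<Rightarrow> nat" where
  "next_touch P n i k = (LEAST s. i \<le> s \<and> ((s, k) \<in> P \<or> n \<le> s))"

lemma next_touch_props:
  "i \<le> next_touch P n i k \<and> ((next_touch P n i k, k) \<in> P \<or> n \<le> next_touch P n i k)"
  unfolding next_touch_def by (rule LeastI[of _ "max i n"]) auto

lemma next_touch_le: "i \<le> s \<Longrightarrow> (s, k) \<in> P \<or> n \<le> s \<Longrightarrow> next_touch P n i k \<le> s"
  unfolding next_touch_def by (rule Least_le) auto

lemma next_touch_le_iff: "i < n \<Longrightarrow> next_touch P n i k \<le> i \<longleftrightarrow> (i, k) \<in> P"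
  using next_touch_props[of i P n k] next_touch_le[of i i k P n]
  by (metis le_antisym linorder_not_le order_refl)

lemma next_touch_Suc:
  assumes "i < n" "(i, k) \<notin> P" 
  shows "next_touch P n i k = next_touch P n (Suc i) k"
proof (rule antisym)
  show "next_touch P n i k \<le> next_touch P n (Suc i) k"
    using next_touch_props[of "Suc i" P n k] by (intro next_touch_le) auto
  have "next_touch P n i k \<noteq> i" using next_touch_props[of i P n k] assms by auto
  then show "next_touch P n (Suc i) k \<le> next_touch P n i k"
    using next_touch_props[of i P n k] by (intro next_touch_le) auto
qed

lemma length_spine_keys: "distinct (inorder (spine ps R)) \<Longrightarrow> card (snd ` set ps) = length ps"
proof (induction ps R rule: spine.induct)
  case (2 L x ps R)
  have "x \<notin> snd ` set ps" using "2.prems" set_spine_keys[of ps R] by auto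
  with 2 show ?case by auto
qed simp

text \<open>Satisfaction says that a key touched at time \<open>i\<close> is touched again no later than every key in the
  neighbouring gaps. Hence any heap on the touched keys extends to the untouched hanging subtrees.\<close>

lemma treap_step:
  fixes P :: "(nat \<times> 'a::linorder) set"
  assumes sat: "right_satisfied (\<lambda>i. i) P" and i: "i < n"
    and t: "sorted_wrt (<) (inorder t)" "heap (next_touch P n i) t"
    and sub: "{k. (i, k) \<in> P} \<subseteq> set_tree t" and q: "(i, q) \<in> P"
  shows "\<exists>t' c. inorder t' = inorder t \<and> heap (next_touch P n (Suc i)) t' \<and> search t q t' c
    \<and> c \<le> 8 * card {k. (i, k) \<in> P}"
proof -
  let ?K = "{k. (i, k) \<in> P}" and ?g = "next_touch P n (Suc i)"
  obtain ps R where f: "flat t ps R" "snd ` set ps = {x \<in> set_tree t. next_touch P n i x \<le> i}"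
    "\<forall>L\<in>hangs ps R. heap (next_touch P n i) L \<and> (\<forall>y\<in>set_tree L. i < next_touch P n i y)"
    using heap_flat[OF t(2), of i] by blast
  have keys: "snd ` set ps = ?K" using f(2) sub next_touch_le_iff[OF i, of P] by auto
  have so: "sorted_wrt (<) (inorder (spine ps R))" using t(1) flat_inorder[OF f(1)] by simp
  have "dominates ?g ps R"
  proof (rule sorted_dominates[OF so, of ?K])
    fix z y assume z: "z \<in> snd ` set ps" "z \<noteq> y"
      and gap: "\<forall>w\<in>?K. w \<noteq> z \<longrightarrow> \<not> (min z y \<le> w \<and> w \<le> max z y)"
    have zi: "(i, z) \<in> P" using z keys by auto
    let ?s = "?g y"
    have s: "Suc i \<le> ?s" "(?s, y) \<in> P \<or> n \<le> ?s" using next_touch_props[of "Suc i" P n y] by auto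
    show "?g z \<le> ?s"
    proof (cases "n \<le> ?s")
      case True then show ?thesis using s by (intro next_touch_le) auto
    next
      case False
      then have "(?s, y) \<in> P" using s by auto
      \<comment> \<open>The horizontal and vertical alternatives are now a later touch of
        \<open>z\<close> and another key touched at time \<open>i\<close> between \<open>z\<close>
        and \<open>y\<close>. The latter contradicts \<open>gap\<close>, so \<open>z\<close> is
        touched again no later than \<open>y\<close>.\<close>
      from right_satisfiedD[OF sat zi this _ z(2)] s gap
      obtain s' where "(s', z) \<in> P" "i < s'" "s' \<le> ?s" by auto
      then show ?thesis using next_touch_le[of "Suc i" s' z P n] by auto
    qed
  qed (use keys in auto)
  moreover have "\<forall>L\<in>hangs ps R. heap ?g L"
  proof
    fix L assume L: "L \<in> hangs ps R"
    show "heap ?g L"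
    proof (rule heap_cong)
      show "heap (next_touch P n i) L" using f(3) L by blast
      show "next_touch P n i x = ?g x" if "x \<in> set_tree L" for x
      proof (rule next_touch_Suc[OF i])
        have "i < next_touch P n i x" using f(3) L that by blast
        then show "(i, x) \<notin> P" using next_touch_le_iff[OF i, of P x] by simp
      qed
    qed
  qed
  ultimately obtain t' where t': "flat t' ps R" "heap ?g t'" using heap_unflat by blast
  obtain c where c: "c \<le> 8 * length ps" "search t q t' c"
    using search_flat[OF f(1) t'(1), of q] q keys by auto
  have "distinct (inorder (spine ps R))" using so by (simp add: strict_sorted_iff)
  then have "card ?K = length ps" using length_spine_keys keys by metis
  then show ?thesis using c t' flat_inorder[OF f(1)] flat_inorder[OF t'(1)] by auto
qed

lemma treap_serve:
  fixes P :: "(nat \<times> 'a::linorder) set"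
  assumes sat: "right_satisfied (\<lambda>i. i) P" and P: "P \<subseteq> {..<length qs} \<times> S"
    and qs: "\<And>i. i < length qs \<Longrightarrow> (i, qs ! i) \<in> P"
    and i: "i \<le> length qs"
    and t: "sorted_wrt (<) (inorder t)" "heap (next_touch P (length qs) i) t" "set_tree t = S"
  shows "\<exists>c. serve t (drop i qs) c \<and> c \<le> 8 * (\<Sum>j=i..<length qs. card {k. (j, k) \<in> P})"
  using i t
proof (induction i arbitrary: t rule: inc_induct)
  case base
  then show ?case using serve.intros(1) by auto
next
  case (step i)
  have "{k. (i, k) \<in> P} \<subseteq> set_tree t" using P step.prems by auto
  from treap_step[OF sat step.hyps(2) step.prems(1,2) this qs[OF step.hyps(2)]]
  obtain t' c where t': "inorder t' = inorder t" "heap (next_touch P (length qs) (Suc i)) t'"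
    "search t (qs ! i) t' c" "c \<le> 8 * card {k. (i, k) \<in> P}" by auto
  have "set_tree t' = S" using t'(1) step.prems by (metis set_inorder)
  then obtain c' where c': "serve t' (drop (Suc i) qs) c'" "c' \<le> 8 * (\<Sum>j=Suc i..<length qs. card {k. (j, k) \<in> P})"
    using step.IH[of t'] t' step.prems by auto
  have "serve t (drop i qs) (c + c')"
    using serve.intros(2)[OF t'(3) c'(1)] step.hyps by (simp add: Cons_nth_drop_Suc)
  then show ?case using c'(2) t'(4) step.hyps by (auto simp: sum.atLeast_Suc_lessThan)
qed

lemma satisfied_serve:
  fixes P :: "(nat \<times> 'a::linorder) set"
  assumes sat: "right_satisfied (\<lambda>i. i) P" and P: "P \<subseteq> {..<length qs} \<times> S" and fin: "finite S"
    and qs: "\<And>i. i < length qs \<Longrightarrow> (i, qs ! i) \<in> P"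
  shows "\<exists>t c. bst t \<and> set_tree t = S \<and> serve t qs c \<and> c \<le> 8 * card P"
proof -
  let ?g = "next_touch P (length qs) 0"
  \<comment> \<open>For the initial tree all keys are top keys and all gaps are empty, so domination
    holds trivially.\<close>
  let ?ps = "map (Pair Leaf) (sorted_list_of_set S)"
  have d: "dominates ?g (map (Pair Leaf) xs) Leaf" for xs
  proof (induction xs)
    case (Cons x xs)
    have "first_hang (map (Pair Leaf) xs) Leaf = Leaf" by (cases xs) auto
    with Cons show ?case by simp
  qed simp
  have inorder: "inorder (spine (map (Pair Leaf) xs) Leaf) = xs" for xs :: "'a list"
    by (induction xs) auto
  obtain t where t: "flat t ?ps Leaf" "heap ?g t"
    using heap_unflat[OF d, of "sorted_list_of_set S"] by (auto simp: hangs_def)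
  have it: "inorder t = sorted_list_of_set S" using flat_inorder[OF t(1)] inorder by metis
  have so: "sorted_wrt (<) (inorder t)" unfolding it by simp
  have set: "set_tree t = S" using it fin by (metis set_inorder set_sorted_list_of_set)
  obtain c where c: "serve t qs c" "c \<le> 8 * (\<Sum>j<length qs. card {k. (j, k) \<in> P})"
    using treap_serve[OF sat P qs _ so t(2) set] by (auto simp: atLeast0LessThan)
  have "P = Sigma {..<length qs} (\<lambda>j. {k. (j, k) \<in> P})" using P by auto
  moreover have "finite {k. (j, k) \<in> P}" for j using P fin by (auto intro: finite_subset)
  ultimately have "card P = (\<Sum>j<length qs. card {k. (j, k) \<in> P})"
    using card_SigmaI[of "{..<length qs}" "\<lambda>j. {k. (j, k) \<in> P}"] by simp
  then show ?thesis using c so set by (auto simp: bst_iff_sorted_wrt_less)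
qed

section \<open>From partition sorts to searches\<close>

text \<open>Why \<open>(x, int x)\<close> is marked: when \<open>x\<close> becomes a singleton, the
  lower end of its range is \<open>x\<close>. The split that isolates it touches an element of each
  output, hence \<open>x\<close>, and marks it in the rows \<open>lo\<close> and \<open>k\<close>,
  one of which is that lower end. A tree of size one at the start undergoes no split, whence the
  side condition.\<close>

lemma psort_run_touched:
  assumes "psort_run alg T c" "set_tree T = {lo..<hi}" "pos_sorted pos T"
  shows "\<exists>P. touched T (int lo) (int hi) P \<and> finite P \<and> card P \<le> 3 * c \<and>
    (size T \<noteq> 1 \<longrightarrow> (\<forall>x\<in>set_tree T. (x, int x) \<in> P))"
  using assms
proof (induction arbitrary: lo hi rule: psort_run.induct)
  case (stop T)
  have "set_tree T \<noteq> {}" using stop.hyps by (cases T) auto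
  then have "lo < hi" unfolding stop.prems(1) by simp
  then have "touched T (int lo) (int hi) {}" by (intro touched.none) simp
  then show ?case using stop.hyps by (intro exI[of _ "{}"]) simp
next
  case (split T \<tau> A B ca cb)
  note fa = bt_partition_facts[OF split.hyps(3) split.prems(2)]
  note fb = bt_partition_facts[OF bt_partition_sym[OF split.hyps(3)] split.prems(2)]
  obtain k where k: "\<forall>x\<in>set_tree A. x < k" "\<forall>x\<in>set_tree B. k \<le> x" using split.hyps(4) by blast
  have un: "set_tree A \<union> set_tree B = {lo..<hi}" using fa(4) split.prems(1) by simp
  obtain a b where a: "a \<in> \<tau>" "a \<in> set_tree A" and b: "b \<in> \<tau>" "b \<in> set_tree B" using fa(3) fb(3) by blast
  have lk: "lo \<le> a" "a < k" "k \<le> b" "b < hi" using a b k un by auto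
  have sA: "set_tree A = {lo..<k}"
  proof
    show "set_tree A \<subseteq> {lo..<k}" using k(1) un by auto
    show "{lo..<k} \<subseteq> set_tree A"
    proof
      fix x assume x: "x \<in> {lo..<k}"
      then have "x \<in> set_tree A \<union> set_tree B" unfolding un using lk by auto
      moreover have "x \<notin> set_tree B" using k(2) x by (auto dest: bspec)
      ultimately show "x \<in> set_tree A" by blast
    qed
  qed
  have sB: "set_tree B = {k..<hi}"
  proof
    show "set_tree B \<subseteq> {k..<hi}" using k(2) un by auto
    show "{k..<hi} \<subseteq> set_tree B"
    proof
      fix x assume x: "x \<in> {k..<hi}"
      then have "x \<in> set_tree A \<union> set_tree B" unfolding un using lk by auto
      moreover have "x \<notin> set_tree A" using k(1) x by (auto dest: bspec)
      ultimately show "x \<in> set_tree B" by blast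
    qed
  qed
  obtain Pa where Pa: "touched A (int lo) (int k) Pa" "finite Pa" "card Pa \<le> 3 * ca"
    "size A \<noteq> 1 \<longrightarrow> (\<forall>x\<in>set_tree A. (x, int x) \<in> Pa)" using split.IH(1)[OF sA fa(6)] by blast
  obtain Pb where Pb: "touched B (int k) (int hi) Pb" "finite Pb" "card Pb \<le> 3 * cb"
    "size B \<noteq> 1 \<longrightarrow> (\<forall>x\<in>set_tree B. (x, int x) \<in> Pb)" using split.IH(2)[OF sB fb(6)] by blast
  let ?Q = "\<tau> \<times> {int lo, int k, int hi}"
  let ?P = "?Q \<union> Pa \<union> Pb"
  have "finite \<tau>" using conn_top_subset[OF fa(1)] finite_subset by fastforce
  have "card ?Q \<le> 3 * card \<tau>"
    using card_insert_le_m1[of 3 "{int k, int hi}" "int lo"] card_insert_le_m1[of 2 "{int hi}" "int k"]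
    by (simp add: card_cartesian_product)
  then have "card ?Q + card Pa + card Pb \<le> 3 * (card \<tau> + ca + cb)" using Pa(3) Pb(3) by simp
  then have "card ?P \<le> 3 * (card \<tau> + ca + cb)"
    using card_Un_le[of "?Q \<union> Pa" Pb] card_Un_le[of ?Q Pa] by (meson add_le_mono1 order_trans)
  moreover have "touched T (int lo) (int hi) ?P"
    by (rule touched.split[OF split.hyps(3) Pa(1) Pb(1)])
  moreover have "(x, int x) \<in> ?P" if x: "x \<in> set_tree T" for x
  proof -
    consider "x \<in> set_tree A" "size A \<noteq> 1" | "x \<in> set_tree A" "size A = 1"
      | "x \<in> set_tree B" "size B \<noteq> 1" | "x \<in> set_tree B" "size B = 1" using x fa(4) by auto
    then show ?thesis
    proof cases
      case 2
      then have "set_tree A = {a}" using a(2) by (cases A) auto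
      moreover have "lo \<in> set_tree A" using sA lk by simp
      ultimately show ?thesis using 2 a(1) by auto
    next
      case 4
      then have "set_tree B = {b}" using b(2) by (cases B) auto
      moreover have "k \<in> set_tree B" using sB lk by simp
      ultimately show ?thesis using 4 b(1) by auto
    qed (use Pa(4) Pb(4) in auto)
  qed
  ultimately show ?case using \<open>finite \<tau>\<close> Pa(2) Pb(2) by (intro exI[of _ ?P]) simp
qed

lemma OPT_BST_le:
  assumes "bst t" "set_tree t = {1..length \<pi>}" "serve t \<pi> c"
  shows "OPT_BST \<pi> \<le> c"
  unfolding OPT_BST_def using assms by (intro Least_le) blast

lemma OPT_BST_le_psort:
  assumes d: "distinct \<pi>" and set: "set \<pi> = {1..length \<pi>}" and T: "inorder T = \<pi>"
    and run: "psort_run alg T c"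
  shows "OPT_BST \<pi> \<le> 24 * c"
proof (cases "length \<pi> = 1")
  case True
  \<comment> \<open>The sort may cost 0 here, so the search must cost 0 too: the pointer starts at
    the root, which is the only key.\<close>
  then have pi: "\<pi> = [1]" using set by (cases \<pi>) auto
  let ?t = "Node Leaf (1::nat) Leaf"
  have "(bst_step ^^ 0) (?t, []) (?t, [])" "key_at (?t, []) = Some 1" by simp_all
  then have "search ?t 1 ?t 0" unfolding search_def
    by (metis add_0)
  then have "serve ?t \<pi> (0 + 0)" unfolding pi by (intro serve.intros)
  then have "OPT_BST \<pi> \<le> 0 + 0" using pi by (intro OPT_BST_le) auto
  then show ?thesis by simp
next
  case False
  define n where "n = length \<pi>"
  define pos where "pos = inv_into {..<n} ((!) \<pi>)"
  have pos: "pos (\<pi> ! i) = i" if "i < n" for i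
    unfolding pos_def using that d by (intro inv_into_f_f) (auto simp: n_def inj_on_nth)
  have sorted: "pos_sorted pos T"
    unfolding pos_sorted_def T sorted_wrt_iff_nth_less using pos n_def by auto
  have setT: "set_tree T = {1..<Suc n}" using set T n_def by (metis atLeastLessThanSuc_atLeastAtMost set_inorder)
  have size: "size T \<noteq> 1" using False T by (metis length_inorder)
  obtain P where P: "touched T (int 1) (int (Suc n)) P" "finite P" "card P \<le> 3 * c"
    "\<forall>x\<in>set_tree T. (x, int x) \<in> P" using psort_run_touched[OF run setT sorted] size by blast
  note sat = touched_right_satisfied[OF P(1) sorted]
  note bounds = touched_bounds[OF P(1)]
  \<comment> \<open>Row \<open>Suc n\<close>, the exclusive upper end of the initial range, is not a
    key and is dropped. Satisfaction survives because a witness lies in row \<open>r\<close> or in a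
    row between those of the two points.\<close>
  define P' where "P' = {(i, k). i < n \<and> k \<le> n \<and> (\<pi> ! i, int k) \<in> P}"
  have "right_satisfied (\<lambda>i. i) P'" unfolding right_satisfied_def
  proof (intro allI impI)
    fix i z j y assume iz: "(i, z) \<in> P'" and jy: "(j, y) \<in> P'" and ij: "i < j" and zy: "z \<noteq> y"
    then have h: "(\<pi> ! i, int z) \<in> P" "(\<pi> ! j, int y) \<in> P" "i < n" "j < n" "z \<le> n" "y \<le> n"
      by (auto simp: P'_def)
    have "pos (\<pi> ! i) < pos (\<pi> ! j)" "int z \<noteq> int y" using h ij zy pos by auto
    from right_satisfiedD[OF sat h(1,2) this]
    show "(\<exists>w. (i, w) \<in> P' \<and> w \<noteq> z \<and> min z y \<le> w \<and> w \<le> max z y) \<or>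
      (\<exists>m. (m, z) \<in> P' \<and> i < m \<and> m \<le> j)"
    proof (elim disjE exE conjE)
      fix r assume r: "(\<pi> ! i, r) \<in> P" "r \<noteq> int z" "min (int z) (int y) \<le> r" "r \<le> max (int z) (int y)"
      then obtain w where w: "r = int w" using bounds[of "\<pi> ! i" r] by (metis nonneg_int_cases of_nat_0_le_iff order_trans)
      then have "(i, w) \<in> P'" "w \<noteq> z" "min z y \<le> w" "w \<le> max z y" using r h by (auto simp: P'_def)
      then show ?thesis by blast
    next
      fix x assume x: "(x, int z) \<in> P" "pos (\<pi> ! i) < pos x" "pos x \<le> pos (\<pi> ! j)"
      then have "x \<in> set \<pi>" using bounds[OF x(1)] T by (metis set_inorder)
      then obtain m where m: "m < n" "x = \<pi> ! m" by (auto simp: in_set_conv_nth n_def)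
      then have "(m, z) \<in> P'" "i < m" "m \<le> j" using x h pos by (auto simp: P'_def)
      then show ?thesis by blast
    qed
  qed
  moreover have "P' \<subseteq> {..<length \<pi>} \<times> {1..n}"
    using bounds by (fastforce simp: P'_def n_def)
  moreover have "(i, \<pi> ! i) \<in> P'" if "i < length \<pi>" for i
  proof -
    have "\<pi> ! i \<in> {1..n}" using set nth_mem[OF that] n_def by simp
    then show ?thesis using that P(4) setT by (auto simp: P'_def n_def)
  qed
  ultimately obtain t c' where t: "bst t" "set_tree t = {1..n}" "serve t \<pi> c'" "c' \<le> 8 * card P'"
    using satisfied_serve[of P' \<pi> "{1..n}"] by auto
  have "inj_on (\<lambda>(i, k). (\<pi> ! i, int k)) P'"
    using d by (auto simp: inj_on_def P'_def n_def nth_eq_iff_index_eq)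
  then have "card P' \<le> card P"
    by (rule card_inj_on_le[OF _ _ P(2)]) (auto simp: P'_def)
  then show ?thesis using OPT_BST_le[of t \<pi> c'] t P(3) n_def by simp
qed

theorem theorem5:
  fixes alg :: "nat tree \<Rightarrow> nat set \<times> nat tree \<times> nat tree"
  shows "\<exists>C::real. \<forall>(\<pi>::nat list) (T::nat tree) (cost::nat).
           distinct \<pi> \<and> set \<pi> = {1..length \<pi>} \<and> inorder T = \<pi> \<and> psort_run alg T cost
           \<longrightarrow> real (OPT_BST \<pi>) \<le> C * real cost"
proof (intro exI allI impI, elim conjE)
  fix \<pi> :: "nat list" and T :: "nat tree" and cost :: nat
  assume "distinct \<pi>" "set \<pi> = {1..length \<pi>}" "inorder T = \<pi>" "psort_run alg T cost"
  then have "OPT_BST \<pi> \<le> 24 * cost" by (rule OPT_BST_le_psort)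
  then show "real (OPT_BST \<pi>) \<le> 24 * real cost" by linarith
qed

end
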